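(* Let $t_0,t_1,\dots,t_6\in\mathbb{C}[[q]]$ be the formal power series solution of the differential system displayed in the context, with $t_{0,0}=\frac15$, $t_{0,1}=24$, $t_{4,0}=0$ and $t_{5,0}\neq0$. Then the series $t_i$ are convergent (have positive radius of convergence), and if one sets $q=e^{2\pi i\frac{x_{21}}{x_{11}}}$ (for $\psi$ near $\infty$, i.e. $z=\psi^{-5}$ near $0$), then, with $a=\frac{2\pi i}{5}$, $$\begin{aligned} t_0&=a^{-3}\psi x_{11}\\ t_1&=a^{-6}\,625\,x_{11}\left(5\psi^3x_{12}+5\psi^4x_{13}+(\psi^5-1)x_{14}\right)\\ t_2&=a^{-9}(-625)\,x_{11}^2\left(5\psi^3x_{11}+(\psi^5-1)x_{13}\right)\\ t_3&=a^{-12}\,625\,x_{11}^3\left(-5\psi^4x_{11}+(\psi^5-1)x_{12}\right)\\ t_4&=a^{-15}x_{11}^5\\ t_5&=a^{-11}\tfrac{-1}{5}(\psi^5-1)x_{11}^2\left(x_{12}x_{21}-x_{11}x_{22}\right)\\ t_6&=a^{-23}\tfrac{1}{25}(\psi^5-1)x_{11}^5\Big(-5\psi^4x_{11}x_{12}x_{21}-2(\psi^5-1)x_{12}^2x_{21}-(\psi^5-1)x_{11}x_{13}x_{21}\\ &\qquad\qquad+5\psi^4x_{11}^2x_{22}+2(\psi^5-1)x_{11}x_{12}x_{22}+(\psi^5-1)x_{11}^2x_{23}\Big). \end{aligned}$$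
   Context: **The differential system.** Write $\dot t=5q\frac{\partial t}{\partial q}$. The system is $$\begin{aligned} \dot t_0&=\tfrac{1}{t_5}\left(\tfrac{6}{5}t_0^5+\tfrac{1}{3125}t_0t_3-\tfrac{1}{5}t_4\right)\\ \dot t_1&=\tfrac{1}{t_5}\left(-125t_0^6+t_0^4t_1+125t_0t_4+\tfrac{1}{3125}t_1t_3\right)\\ \dot t_2&=\tfrac{1}{t_5}\left(-1875t_0^7-\tfrac{1}{5}t_0^5t_1+2t_0^4t_2+1875t_0^2t_4+\tfrac{1}{5}t_1t_4+\tfrac{2}{3125}t_2t_3\right)\\ \dot t_3&=\tfrac{1}{t_5}\left(-3125t_0^8-\tfrac{1}{5}t_0^5t_2+3t_0^4t_3+3125t_0^3t_4+\tfrac{1}{5}t_2t_4+\tfrac{3}{3125}t_3^2\right)\\ \dot t_4&=\tfrac{1}{t_5}\left(5t_0^4t_4+\tfrac{1}{625}t_3t_4\right)\\ \dot t_5&=\tfrac{t_6}{t_5}\\ \dot t_6&=\left(-\tfrac{72}{5}t_0^8-\tfrac{24}{3125}t_0^4t_3-\tfrac{3}{5}t_0^3t_4-\tfrac{2}{1953125}t_3^2\right)+\tfrac{t_6}{t_5}\left(12t_0^4+\tfrac{2}{625}t_3\right) \end{aligned}$$ Write $t_i=\sum_{n\ge0}t_{i,n}q^n$. The conditions $t_{0,0}=\frac15$, $t_{0,1}=24$, $t_{4,0}=0$, $t_{5,0}\ne0$ determine all coefficients $t_{i,n}$ uniquely (in particular $t_{5,0}=-\frac1{3125}$). **The family and the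 periods.** $W_\psi$ is the variety obtained by resolution of singularities of the quotient of $\{Q=0\}\subset\mathbb{P}^4$, $Q=x_0^5+x_1^5+x_2^5+x_3^5+x_4^5-5\psi x_0x_1x_2x_3x_4$, by the group $G=\{(\zeta_1,\dots,\zeta_5)\mid\zeta_i^5=1,\ \zeta_1\zeta_2\zeta_3\zeta_4\zeta_5=1\}$ acting diagonally on the coordinates. The form $\Omega=\frac{x_4\,dx_0\wedge dx_1\wedge dx_2}{\partial Q/\partial x_3}$ induces a holomorphic $3$-form on $W_\psi$, again denoted $\Omega$. For cycles $\delta_i$ in $H_3(W_\psi,\mathbb{Q})$ (continued flatly in $\psi$) set $$x_{ij}=\frac{\partial^{j-1}}{\partial\psi^{j-1}}\int_{\delta_i}\Omega .$$ Only $i=1,2$ occur in the statement. The cycles $\delta_1,\delta_2$ are members of a particular basis of $H_3(W_\psi,\mathbb{Q})$, and their periods are, with $\tilde z=\psi^{-5}/5^5$ and $\psi$ near $\infty$, $$\int_{\delta_1}\Omega=\psi^{-1}\frac{(2\pi i)^3}{5^4}h_0(\tilde z),\qquad \int_{\delta_2}\Omega=\psi^{-1}\frac{(2\pi i)^2}{5^4}h_1(\tilde z),$$ where $$h_0=\sum_{m\ge0}\frac{(5m)!}{(m!)^5}\tilde z^m,\qquad h_1=\ln(\tilde z)\,h_0+5\sum_{m\ge1}\frac{(5m)!}{(m!)^5}\Big(\sum_{k=m+1}^{5m}\frac1k\Big)\tilde z^m .$$ Thus $e^{2\pi i x_{21}/x_{11}}=e^{h_1/h_0}=\tilde z+O(\tilde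 z^2)$ is single-valued in $\tilde z$ near $0$. (A branch of $\ln$ is fixed locally.) *)

theory Defs
  imports "HOL-Analysis.Analysis"
begin

definition dot :: "complex fps \<Rightarrow> complex fps" where
  "dot t = 5 * fps_X * fps_deriv t"

text \<open>
  The division by \<open>t 5\<close> is the division of formal power series; it is multiplication by the
  multiplicative inverse as soon as the constant term of \<open>t 5\<close> is non-zero.
\<close>

definition differential_system :: "(nat \<Rightarrow> complex fps) \<Rightarrow> bool" where
  "differential_system t \<longleftrightarrow>
     dot (t 0) = (fps_const (6/5) * t 0 ^ 5 + fps_const (1/3125) * t 0 * t 3
                  - fps_const (1/5) * t 4) / t 5 \<and>
     dot (t 1) = (- 125 * t 0 ^ 6 + t 0 ^ 4 * t 1 + 125 * t 0 * t 4
                  + fps_const (1/3125) * t 1 * t 3) / t 5 \<and>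
     dot (t 2) = (- 1875 * t 0 ^ 7 - fps_const (1/5) * t 0 ^ 5 * t 1 + 2 * t 0 ^ 4 * t 2
                  + 1875 * t 0 ^ 2 * t 4 + fps_const (1/5) * t 1 * t 4
                  + fps_const (2/3125) * t 2 * t 3) / t 5 \<and>
     dot (t 3) = (- 3125 * t 0 ^ 8 - fps_const (1/5) * t 0 ^ 5 * t 2 + 3 * t 0 ^ 4 * t 3
                  + 3125 * t 0 ^ 3 * t 4 + fps_const (1/5) * t 2 * t 4
                  + fps_const (3/3125) * t 3 ^ 2) / t 5 \<and>
     dot (t 4) = (5 * t 0 ^ 4 * t 4 + fps_const (1/625) * t 3 * t 4) / t 5 \<and>
     dot (t 5) = t 6 / t 5 \<and>
     dot (t 6) = (- fps_const (72/5) * t 0 ^ 8 - fps_const (24/3125) * t 0 ^ 4 * t 3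
                  - fps_const (3/5) * t 0 ^ 3 * t 4 - fps_const (2/1953125) * t 3 ^ 2)
                 + t 6 / t 5 * (12 * t 0 ^ 4 + fps_const (2/625) * t 3)"

definition z_tilde :: "complex \<Rightarrow> complex" where
  "z_tilde \<psi> = 1 / (5 ^ 5 * \<psi> ^ 5)"

definition h0 :: "complex \<Rightarrow> complex" where
  "h0 z = (\<Sum>m. fact (5 * m) / fact m ^ 5 * z ^ m)"

text \<open>
  The argument \<open>l\<close> of \<open>h1\<close> is the value of the chosen branch of the logarithm at \<open>z\<close>.
  The summand for \<open>m = 0\<close> vanishes, its inner sum being empty.
\<close>

definition h1 :: "complex \<Rightarrow> complex \<Rightarrow> complex" where
  "h1 l z = l * h0 z +
     5 * (\<Sum>m. fact (5 * m) / fact m ^ 5 * (\<Sum>k = m + 1..5 * m. 1 / of_nat k) * z ^ m)"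

text \<open>
  A branch on \<open>U\<close> of \<open>\<psi> \<mapsto> ln (z_tilde \<psi>)\<close>.
\<close>

definition log_branch :: "complex set \<Rightarrow> (complex \<Rightarrow> complex) \<Rightarrow> bool" where
  "log_branch U L \<longleftrightarrow> L holomorphic_on U \<and> (\<forall>\<psi>\<in>U. exp (L \<psi>) = z_tilde \<psi>)"

text \<open>
  The periods of the holomorphic 3-form \<open>\<Omega>\<close> on the mirror quintic family over the two cycles
  \<open>\<delta>\<^sub>1\<close>, \<open>\<delta>\<^sub>2\<close>, given near \<open>\<psi> = \<infinity>\<close> by their explicit expansions.  The second one depends on the
  branch \<open>L\<close> of the logarithm.
\<close>

definition period1 :: "complex \<Rightarrow> complex" where
  "period1 \<psi> = 1 / \<psi> * ((2 * of_real pi * \<i>) ^ 3 / 5 ^ 4) * h0 (z_tilde \<psi>)"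

definition period2 :: "(complex \<Rightarrow> complex) \<Rightarrow> complex \<Rightarrow> complex" where
  "period2 L \<psi> = 1 / \<psi> * ((2 * of_real pi * \<i>) ^ 2 / 5 ^ 4) * h1 (L \<psi>) (z_tilde \<psi>)"

definition x1 :: "nat \<Rightarrow> complex \<Rightarrow> complex" where
  "x1 j = (deriv ^^ (j - 1)) period1"

definition x2 :: "(complex \<Rightarrow> complex) \<Rightarrow> nat \<Rightarrow> complex \<Rightarrow> complex" where
  "x2 L j = (deriv ^^ (j - 1)) (period2 L)"

end

theory Submission
  imports Defs "HOL-Complex_Analysis.Complex_Analysis"
begin

text \<open>
  Both sides of the claim are compared as power series. Write the two periods as
  \<open>h\<close> and \<open>log z \<cdot> h + g\<close> with power series \<open>h\<close>, \<open>g\<close>, and let \<open>\<theta> = z d/dz\<close>. In terms of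
  \<open>h\<close>, \<open>g\<close> and their \<open>\<theta>\<close>-derivatives the right-hand sides of the claim are polynomials, and
  \<open>q = z exp (g/h)\<close>. Since \<open>q d/dq = (\<theta> log q)\<^sup>-\<^sup>1 \<theta>\<close>, the first five equations of the system
  become consequences of the Picard-Fuchs equation for \<open>h\<close>. The last one expresses the
  second derivative of \<open>W = h\<^sup>2 \<theta> log q\<close> by lower ones; it holds because the self-dual Picard-Fuchs
  operator has a skew-symmetric bilinear concomitant, which is constant on pairs of
  solutions and vanishes at \<open>z = 0\<close> on this pair. Composing with the (convergent) inverse of
  \<open>q(z)\<close> yields a convergent solution of the system.

  The system has only one solution with the given initial values: at order \<open>n\<close> it is linear in the
  \<open>n\<close>-th coefficients, the Jacobian at the constant terms is nilpotent on \<open>t\<^sub>0, \<dots>, t\<^sub>3\<close>, and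
  \<open>t\<^sub>4\<close> contributes the eigenvalue that forces \<open>t\<^sub>5\<close> to have constant term \<open>-1/3125\<close> and produces a
  resonance at order \<open>1\<close> only, where \<open>24\<close> fixes the remaining freedom.
\<close>

section \<open>Uniqueness of the formal solution\<close>

text \<open>Multiplied out by \<open>t 5\<close>, so that coefficients can be compared without
  division; in the last equation the quotient \<open>t 6 / t 5\<close> has become
  \<open>dot (t 5)\<close>.\<close>

definition cleared_system :: "(nat \<Rightarrow> complex fps) \<Rightarrow> bool" where
  "cleared_system t \<longleftrightarrow>
     t 5 * dot (t 0) = fps_const (6/5) * t 0 ^ 5 + fps_const (1/3125) * t 0 * t 3
                  - fps_const (1/5) * t 4 \<and>
     t 5 * dot (t 1) = - 125 * t 0 ^ 6 + t 0 ^ 4 * t 1 + 125 * t 0 * t 4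
                  + fps_const (1/3125) * t 1 * t 3 \<and>
     t 5 * dot (t 2) = - 1875 * t 0 ^ 7 - fps_const (1/5) * t 0 ^ 5 * t 1 + 2 * t 0 ^ 4 * t 2
                  + 1875 * t 0 ^ 2 * t 4 + fps_const (1/5) * t 1 * t 4
                  + fps_const (2/3125) * t 2 * t 3 \<and>
     t 5 * dot (t 3) = - 3125 * t 0 ^ 8 - fps_const (1/5) * t 0 ^ 5 * t 2 + 3 * t 0 ^ 4 * t 3
                  + 3125 * t 0 ^ 3 * t 4 + fps_const (1/5) * t 2 * t 4
                  + fps_const (3/3125) * t 3 ^ 2 \<and>
     t 5 * dot (t 4) = 5 * t 0 ^ 4 * t 4 + fps_const (1/625) * t 3 * t 4 \<and>
     t 5 * dot (t 5) = t 6 \<and>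
     dot (t 6) = (- fps_const (72/5) * t 0 ^ 8 - fps_const (24/3125) * t 0 ^ 4 * t 3
                  - fps_const (3/5) * t 0 ^ 3 * t 4 - fps_const (2/1953125) * t 3 ^ 2)
                 + dot (t 5) * (12 * t 0 ^ 4 + fps_const (2/625) * t 3)"

lemma fps_eq_divide_iff:
  fixes f g h :: "'a::field fps"
  assumes "fps_nth h 0 \<noteq> 0"
  shows "f = g / h \<longleftrightarrow> h * f = g"
proof -
  have "h dvd g" using assms by (simp add: fps_is_unit_iff unit_imp_dvd)
  moreover have "h \<noteq> 0" using assms by auto
  ultimately show ?thesis by auto
qed

lemma differential_system_iff_cleared:
  assumes "fps_nth (t 5) 0 \<noteq> 0"
  shows "differential_system t \<longleftrightarrow> cleared_system t"
  unfolding differential_system_def cleared_system_def fps_eq_divide_iff[OF assms, symmetric]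
  by (intro conj_cong refl) auto

section \<open>Calculus of first differences of power series\<close>

text \<open>In other words \<open>f = g + d q^n\<close> modulo \<open>q^(n+1)\<close>. The rules
  below compute \<open>d\<close> for compound expressions, which linearises the system at order
  \<open>n\<close> mechanically.\<close>

definition first_diff :: "nat \<Rightarrow> complex fps \<Rightarrow> complex fps \<Rightarrow> complex \<Rightarrow> bool" where
  "first_diff n f g d \<longleftrightarrow> (\<forall>k<n. fps_nth f k = fps_nth g k) \<and> fps_nth f n = fps_nth g n + d"

lemma first_diff_unique: "first_diff n f g d \<Longrightarrow> first_diff n f g d' \<Longrightarrow> d = d'"
  by (simp add: first_diff_def)

lemma first_diff_refl: "first_diff n f f 0"
  by (simp add: first_diff_def)

lemma first_diff_add:
  "first_diff n f g d \<Longrightarrow> first_diff n f' g' d' \<Longrightarrow> first_diff n (f + f') (g + g') (d + d')"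
  by (simp add: first_diff_def)

lemma first_diff_diff:
  "first_diff n f g d \<Longrightarrow> first_diff n f' g' d' \<Longrightarrow> first_diff n (f - f') (g - g') (d - d')"
  by (simp add: first_diff_def)

text \<open>The product rule. The quadratic term \<open>d * d'\<close> sits at order
  \<open>2 * n\<close>, which lies beyond \<open>n\<close> because \<open>n > 0\<close>.\<close>

lemma first_diff_mult:
  assumes "first_diff n f g d" "first_diff n f' g' d'" "n > 0"
  shows "first_diff n (f * f') (g * g') (fps_nth f 0 * d' + d * fps_nth f' 0)"
proof -
  have lt: "fps_nth f k = fps_nth g k" "fps_nth f' k = fps_nth g' k" if "k < n" for k
    using assms that by (auto simp: first_diff_def)
  have "fps_nth (f * f') k = fps_nth (g * g') k" if "k < n" for k
    unfolding fps_mult_nth using that by (intro sum.cong) (auto simp: lt)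
  moreover have "fps_nth (f * f') n = fps_nth (g * g') n + (fps_nth f 0 * d' + d * fps_nth f' 0)"
  proof -
    obtain m where m: "n = Suc m" using assms(3) gr0_implies_Suc by blast
    have split: "fps_nth (p * r) n = fps_nth p 0 * fps_nth r n
        + (\<Sum>i=1..m. fps_nth p i * fps_nth r (n - i)) + fps_nth p n * fps_nth r 0" for p r :: "complex fps"
      unfolding fps_mult_nth m by (simp add: sum.atLeast_Suc_atMost)
    have "(\<Sum>i=1..m. fps_nth f i * fps_nth f' (n - i)) = (\<Sum>i=1..m. fps_nth g i * fps_nth g' (n - i))"
      by (intro sum.cong) (auto simp: lt m)
    moreover have "fps_nth f n = fps_nth g n + d" "fps_nth f' n = fps_nth g' n + d'"
      using assms by (auto simp: first_diff_def)
    ultimately show ?thesis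
      using lt[of 0] assms(3) unfolding split by (simp add: algebra_simps)
  qed
  ultimately show ?thesis by (simp add: first_diff_def)
qed

lemma first_diff_power:
  assumes "first_diff n f g d" "n > 0"
  shows "first_diff n (f ^ k) (g ^ k) (of_nat k * fps_nth f 0 ^ (k - 1) * d)"
proof (induction k)
  case 0
  show ?case by (simp add: first_diff_refl)
next
  case (Suc k)
  have "fps_nth f 0 * (of_nat k * fps_nth f 0 ^ (k - 1) * d) + d * fps_nth (f ^ k) 0
      = of_nat (Suc k) * fps_nth f 0 ^ (Suc k - 1) * d"
    by (cases k) (simp_all add: algebra_simps fps_nth_power_0)
  with first_diff_mult[OF assms(1) Suc assms(2)] show ?case by simp
qed

lemma dot_nth: "fps_nth (dot f) n = 5 * of_nat n * fps_nth f n"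
  by (cases n) (simp_all add: dot_def mult.assoc)

lemma first_diff_dot:
  "first_diff n f g d \<Longrightarrow> first_diff n (dot f) (dot g) (5 * of_nat n * d)"
  by (simp add: first_diff_def dot_nth algebra_simps)

lemmas first_diff_intros = first_diff_refl first_diff_add first_diff_diff first_diff_mult
  first_diff_power first_diff_dot

section \<open>Constant terms and the linearisation there\<close>

definition base_point :: "(nat \<Rightarrow> complex fps) \<Rightarrow> bool" where
  "base_point t \<longleftrightarrow> fps_nth (t 0) 0 = 1/5 \<and> fps_nth (t 1) 0 = -25 \<and> fps_nth (t 2) 0 = -35 \<and>
     fps_nth (t 3) 0 = -6 \<and> fps_nth (t 4) 0 = 0 \<and> fps_nth (t 6) 0 = 0"

text \<open>Every \<open>dot\<close> has constant term 0, so order 0 of the system is polynomial.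
  Its first three equations give \<open>t 3\<close>, \<open>t 1\<close>, \<open>t 2\<close> in turn,
  and the one for \<open>t 5\<close> gives \<open>t 6\<close>. The constant term of
  \<open>t 5\<close> stays free at this order.\<close>

lemma base_pointI:
  assumes "cleared_system t" "fps_nth (t 0) 0 = 1/5" "fps_nth (t 4) 0 = 0"
  shows "base_point t"
proof -
  have n0: "fps_nth a 0 = fps_nth b 0" if "a = b" for a b :: "complex fps" using that by simp
  note C = assms(1)[unfolded cleared_system_def]
  have E0: "fps_nth (t 3) 0 = -6"
    using n0[OF C[THEN conjunct1]] assms(2,3)
    by (simp add: dot_nth fps_nth_power_0 power_numeral_reduce field_simps add_eq_0_iff)
  have E1: "fps_nth (t 1) 0 = -25"
    using n0[OF C[THEN conjunct2, THEN conjunct1]] assms(2,3) E0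
    by (simp add: dot_nth fps_nth_power_0 power_numeral_reduce field_simps minus_equation_iff[of "fps_nth _ _"] del: One_nat_def)
  have "2 * fps_nth (t 2) 0 = -70"
    using n0[OF C[THEN conjunct2, THEN conjunct2, THEN conjunct1]] assms(2,3) E0 E1
    by (simp add: dot_nth fps_nth_power_0 power_numeral_reduce field_simps
        minus_equation_iff[of "_ * _"] del: One_nat_def)
  hence E2: "fps_nth (t 2) 0 = -35" by simp
  have "t 5 * dot (t 5) = t 6" using C by (elim conjE)
  from n0[OF this] have "fps_nth (t 6) 0 = 0" by (simp add: dot_nth)
  with assms E0 E1 E2 show ?thesis by (simp add: base_point_def)
qed


lemma first_diff_eq_elim:
  \<comment> \<open>Subtracts the same equation for two solutions. The schematic \<open>e\<close>
    and \<open>e'\<close> are filled in by the rules for \<open>first_diff\<close>, and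
    \<open>e = e'\<close> is the linearised equation.\<close>
  "p = p' \<Longrightarrow> r = r' \<Longrightarrow> first_diff n p r e \<Longrightarrow> first_diff n p' r' e' \<Longrightarrow> (e = e' \<Longrightarrow> Q) \<Longrightarrow> Q"
  using first_diff_unique by blast

text \<open>The Jacobian at the base point, with the first five equations scaled by 625.
  \<open>d 5\<close> drops out of these since every \<open>dot\<close> has constant term 0, and out
  of the last one since \<open>12 * t 0 ^ 4 + 2/625 * t 3\<close> vanishes at the base
  point.\<close>

lemma linearised_system:
  assumes sys: "cleared_system t" "cleared_system s" and base: "base_point t"
    and diff: "\<And>i. i \<le> 6 \<Longrightarrow> first_diff n (t i) (s i) (d i)" and n: "n > 0"
  defines "c \<equiv> fps_nth (t 5) 0"
  shows "3125 * of_nat n * c * d 0 = 24/5 * d 0 + d 3 / 25 - 125 * d 4"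
    and "3125 * of_nat n * c * d 1 = -650 * d 0 - d 1 / 5 - 5 * d 3 + 15625 * d 4"
    and "3125 * of_nat n * c * d 2 = -1900 * d 0 - d 1 / 25 - 2/5 * d 2 - 14 * d 3 + 43750 * d 4"
    and "3125 * of_nat n * c * d 3 = -525 * d 0 - d 2 / 25 - 21/5 * d 3 + 11250 * d 4"
    and "3125 * of_nat n * c * d 4 = - d 4"
    and "5 * of_nat n * c * d 5 = d 6"
    and "d 0 = 0 \<Longrightarrow> d 3 = 0 \<Longrightarrow> d 4 = 0 \<Longrightarrow> d 6 = 0"
proof -
  have D: "first_diff n (t 0) (s 0) (d 0)" "first_diff n (t 1) (s 1) (d 1)"
    "first_diff n (t 2) (s 2) (d 2)" "first_diff n (t 3) (s 3) (d 3)"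
    "first_diff n (t 4) (s 4) (d 4)" "first_diff n (t 5) (s 5) (d 5)" "first_diff n (t 6) (s 6) (d 6)"
    by (simp_all add: diff)
  note I = D first_diff_intros n
  note T = sys(1)[unfolded cleared_system_def]
  note S = sys(2)[unfolded cleared_system_def]
  note B = base[unfolded base_point_def] c_def dot_nth fps_nth_power_0 field_simps
  show "3125 * of_nat n * c * d 0 = 24/5 * d 0 + d 3 / 25 - 125 * d 4"
    by (rule first_diff_eq_elim[OF T[THEN conjunct1] S[THEN conjunct1]], (rule I)+, simp add: B del: One_nat_def, algebra?)
  note T = T[THEN conjunct2] and S = S[THEN conjunct2]
  show "3125 * of_nat n * c * d 1 = -650 * d 0 - d 1 / 5 - 5 * d 3 + 15625 * d 4"
    by (rule first_diff_eq_elim[OF T[THEN conjunct1] S[THEN conjunct1]], (rule I)+, simp add: B del: One_nat_def, algebra?)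
  note T = T[THEN conjunct2] and S = S[THEN conjunct2]
  show "3125 * of_nat n * c * d 2 = -1900 * d 0 - d 1 / 25 - 2/5 * d 2 - 14 * d 3 + 43750 * d 4"
    by (rule first_diff_eq_elim[OF T[THEN conjunct1] S[THEN conjunct1]], (rule I)+, simp add: B del: One_nat_def, algebra?)
  note T = T[THEN conjunct2] and S = S[THEN conjunct2]
  show "3125 * of_nat n * c * d 3 = -525 * d 0 - d 2 / 25 - 21/5 * d 3 + 11250 * d 4"
    by (rule first_diff_eq_elim[OF T[THEN conjunct1] S[THEN conjunct1]], (rule I)+, simp add: B del: One_nat_def, algebra?)
  note T = T[THEN conjunct2] and S = S[THEN conjunct2]
  show "3125 * of_nat n * c * d 4 = - d 4"
    by (rule first_diff_eq_elim[OF T[THEN conjunct1] S[THEN conjunct1]], (rule I)+, simp add: B del: One_nat_def, algebra?)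
  note T = T[THEN conjunct2] and S = S[THEN conjunct2]
  show "5 * of_nat n * c * d 5 = d 6"
    by (rule first_diff_eq_elim[OF T[THEN conjunct1] S[THEN conjunct1]], (rule I)+, simp add: B del: One_nat_def, algebra?)
  note T = T[THEN conjunct2] and S = S[THEN conjunct2]
  show "d 6 = 0" if "d 0 = 0" "d 3 = 0" "d 4 = 0"
    by (rule first_diff_eq_elim[OF T S], (rule I)+, use that n in \<open>simp add: B\<close>)
qed

text \<open>Here \<open>\<mu>\<close> is \<open>3125 * n * c\<close>. Three of the equations give
  \<open>d3\<close>, \<open>d2\<close>, \<open>d1\<close> in terms of \<open>d0\<close> and
  \<open>d4\<close>; the remaining one then carries the characteristic polynomial, which is
  \<open>\<mu> ^ 4\<close> by nilpotency. The cubic factor is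
  \<open>(5 * \<mu> + 1) * (5 * \<mu> + 2) * (5 * \<mu> + 3)\<close>.\<close>

lemma nilpotent_block:
  fixes \<mu> :: complex
  assumes "\<mu> * d0 = 24/5 * d0 + d3 / 25 - 125 * d4"
    and "\<mu> * d1 = -650 * d0 - d1 / 5 - 5 * d3 + 15625 * d4"
    and "\<mu> * d2 = -1900 * d0 - d1 / 25 - 2/5 * d2 - 14 * d3 + 43750 * d4"
    and "\<mu> * d3 = -525 * d0 - d2 / 25 - 21/5 * d3 + 11250 * d4"
  shows "\<mu> ^ 4 * d0 = - (6 + 55 * \<mu> + 150 * \<mu> ^ 2 + 125 * \<mu> ^ 3) * d4"
    and "d0 = 0 \<Longrightarrow> d4 = 0 \<Longrightarrow> d1 = 0 \<and> d2 = 0 \<and> d3 = 0"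
proof -
  have d3: "d3 = 25 * (\<mu> * d0 - 24/5 * d0 + 125 * d4)"
    using assms(1) by algebra
  have d2: "d2 = 25 * (-525 * d0 - 21/5 * d3 + 11250 * d4 - \<mu> * d3)"
    using assms(4) by algebra
  have d1: "d1 = 25 * (-1900 * d0 - 2/5 * d2 - 14 * d3 + 43750 * d4 - \<mu> * d2)"
    using assms(3) by algebra
  show "\<mu> ^ 4 * d0 = - (6 + 55 * \<mu> + 150 * \<mu> ^ 2 + 125 * \<mu> ^ 3) * d4"
    using assms(2) unfolding d1 d2 d3 by algebra
  show "d0 = 0 \<Longrightarrow> d4 = 0 \<Longrightarrow> d1 = 0 \<and> d2 = 0 \<and> d3 = 0"
    using d1 d2 d3 by simp
qed

text \<open>The base point is a stationary solution. Comparing \<open>t\<close> with it applies the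
  linearisation to the order 1 coefficients of \<open>t\<close> itself.\<close>

lemma cleared_system_const:
  assumes "cleared_system t" "base_point t"
  shows "cleared_system (\<lambda>i. fps_const (fps_nth (t i) 0))"
proof -
  have [simp]: "dot 0 = 0" "dot (fps_const a) = 0" for a by (simp_all add: dot_def)
  have v: "fps_nth (t 0) 0 = 1/5" "fps_nth (t 1) 0 = -25" "fps_nth (t 2) 0 = -35"
      "fps_nth (t 3) 0 = -6" "fps_nth (t 4) 0 = 0" "fps_nth (t 6) 0 = 0"
    using assms(2) by (simp_all add: base_point_def)
  show ?thesis
    unfolding cleared_system_def v
    by (simp add: fps_const_power numeral_fps_const power_numeral_reduce)
qed

text \<open>At order 1 the nilpotent block turns a non-zero coefficient of \<open>t 0\<close> into a
  non-zero one of \<open>t 4\<close>, so the factor \<open>3125 * c + 1\<close> in the linearised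
  equation for \<open>t 4\<close> must vanish.\<close>

lemma constant_term_t5:
  assumes "cleared_system t" "base_point t" "fps_nth (t 0) 1 \<noteq> 0" "fps_nth (t 5) 0 \<noteq> 0"
  shows "fps_nth (t 5) 0 = -1/3125"
proof -
  let ?s = "\<lambda>i. fps_const (fps_nth (t i) 0)"
  have "first_diff 1 (t i) (?s i) (fps_nth (t i) 1)" for i
    by (simp add: first_diff_def)
  note L = linearised_system[OF assms(1) cleared_system_const[OF assms(1,2)] assms(2) this zero_less_one]
  have "fps_nth (t 4) 1 \<noteq> 0"
    using nilpotent_block(1)[OF L(1-4)] assms(3,4) by auto
  moreover have "(3125 * fps_nth (t 5) 0 + 1) * fps_nth (t 4) 1 = 0"
    using L(5) by (simp add: algebra_simps)
  ultimately have "3125 * fps_nth (t 5) 0 = -1" by (simp add: eq_neg_iff_add_eq_0)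
  moreover have "fps_nth (t 5) 0 = 3125 * fps_nth (t 5) 0 / 3125" by simp
  ultimately show ?thesis by simp
qed

theorem system_unique:
  assumes t: "cleared_system t" "fps_nth (t 0) 0 = 1/5" "fps_nth (t 0) 1 = 24"
      "fps_nth (t 4) 0 = 0" "fps_nth (t 5) 0 \<noteq> 0"
    and s: "cleared_system s" "fps_nth (s 0) 0 = 1/5" "fps_nth (s 0) 1 = 24"
      "fps_nth (s 4) 0 = 0" "fps_nth (s 5) 0 \<noteq> 0"
    and "i \<le> 6"
  shows "t i = s i"
proof -
  note bt = base_pointI[OF t(1,2,4)] and bs = base_pointI[OF s(1,2,4)]
  have ct: "fps_nth (t 5) 0 = -1/3125" using constant_term_t5[OF t(1) bt] t by simp
  have cs: "fps_nth (s 5) 0 = -1/3125" using constant_term_t5[OF s(1) bs] s by simp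
  have i7: "i = 0 \<or> i = 1 \<or> i = 2 \<or> i = 3 \<or> i = 4 \<or> i = 5 \<or> i = 6" if "i \<le> 6" for i :: nat
    using that by arith
  have "\<forall>i\<le>6. fps_nth (t i) n = fps_nth (s i) n" for n
  proof (induction n rule: less_induct)
    case (less n)
    show ?case
    proof (cases "n = 0")
      case True
      thus ?thesis using bt bs ct cs i7 unfolding base_point_def by metis
    next
      case False
      define d where "d i = fps_nth (t i) n - fps_nth (s i) n" for i
      have D: "first_diff n (t i) (s i) (d i)" if "i \<le> 6" for i
        using less that by (simp add: first_diff_def d_def)
      have n: "n > 0" using False by simp
      note L = linearised_system[OF t(1) s(1) bt D n, unfolded ct]
      have [simp]: "3125 * of_nat n * (-1/3125) = - (of_nat n :: complex)" by simp
      note N = nilpotent_block[OF L(1-4), simplified]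
      \<comment> \<open>Now \<open>\<mu> = - n\<close>, and the equation for \<open>t 4\<close>
        reads \<open>n * d 4 = d 4\<close>. At the resonance \<open>n = 1\<close> it says nothing;
        there the block gives \<open>d 0 = 24 * d 4\<close>, and \<open>d 0 = 0\<close> is
        prescribed.\<close>
      have d4: "d 4 = 0"
      proof (cases "n = 1")
        case True
        with t s have "d 0 = 0" by (simp add: d_def)
        with N(1) True show ?thesis by simp
      next
        case False
        hence "of_nat n \<noteq> (1::complex)" by simp
        with L(5) show ?thesis by auto
      qed
      have d0: "d 0 = 0" using N(1) n d4 by simp
      have d13: "d 1 = 0 \<and> d 2 = 0 \<and> d 3 = 0" using nilpotent_block(2)[OF L(1-4) d0 d4] .
      have d6: "d 6 = 0" using L(7) d0 d4 d13 by blast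
      have "d 5 = 0" using L(6) d6 n by simp
      with d0 d13 d4 d6 have "d i = 0" if "i \<le> 6" for i using i7[OF that] by auto
      thus ?thesis by (simp add: d_def)
    qed
  qed
  with \<open>i \<le> 6\<close> show ?thesis by (simp add: fps_eq_iff)
qed

section \<open>The Picard-Fuchs equation\<close>

text \<open>
  The identities behind the system, abstracted from power series: \<open>h\<^sub>k = \<theta>\<^sup>k h\<close>, \<open>u = 1/5\<close>, the
  assumption \<open>L\<close> is the Picard-Fuchs equation and \<open>R\<close> the vanishing of the concomitant.  The
  \<open>e\<^sub>k\<close> are the derivatives of the period with respect to \<open>\<psi>\<close>, up to powers of \<open>\<psi>\<close>.
\<close>

context
  fixes z u h h1 h2 h3 h4 c e1 e2 e3 e1' e2' e3' W W1 W2 s0 s1 s2 s3 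
    s4 K s5 s5' s5'' K' s6 :: "'a::idom"
  assumes u: "5 * u = 1"
    and c: "c = 1 - 3125 * z"
    and L: "c * h4 = z * (6250 * h3 + 4375 * h2 + 1250 * h1 + 120 * h)"
    and R: "h * c * W2 = 2 * c * (h1 * W1 - h2 * W) + h * z * (3125 * W1 + 1250 * W)"
    and e: "e1 = -5 * h1 - h" "e2 = 25 * h2 + 15 * h1 + 2 * h"
      "e3 = -125 * h3 - 150 * h2 - 55 * h1 - 6 * h"
    and e': "e1' = -5 * h2 - h1" "e2' = 25 * h3 + 15 * h2 + 2 * h1"
      "e3' = -125 * h4 - 150 * h3 - 55 * h2 - 6 * h1"
    and ds0: "s0 = u * h"
    and ds1: "s1 = 25 * h * (5 * e1 + 5 * e2 + c * e3)"
    and ds2: "s2 = - 5 * h^2 * (5 * h + c * e2)"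
    and ds3: "s3 = h^3 * (- 5 * h + c * e1)"
    and ds4: "s4 = z * h^5"
    and dK: "K = - (u^4 * c * h^4)"
    and ds5: "s5 = - (u^5 * c * h^2 * W)"
    and ds5p: "s5' = - 1 * u^5 * ((- 3125 * z) * h^2 * W + c * 2 * h * h1 * W + c * h^2 * W1)"
    and ds5pp: "s5'' = - 1 * u^5 * ((- 3125 * z) * h^2 * W + 2 * ((-3125 * z) * 2 * h * h1 * W + (-3125 * z) * h^2 * W1) +
    c * 2 * (h1 * h1 * W + h * h2 * W + h * h1 * W1) + c * (2 * h * h1 * W1 + h^2 * W2))"
    and dKp: "K' = - 1 * u^4 * ((-3125 * z) * h^4 + c * 4 * h^3 * h1)"
    and ds6: "s6 = K * s5'"
begin


lemma period_identity_0: "K * (u * h1) = 6 * u * s0^5 + u^5 * s0 * s3 - u * s4"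
  unfolding ds0 ds3 ds4 dK e c using u by algebra

text \<open>The derivative of \<open>s1\<close> contains \<open>e3'\<close> and with it
  \<open>h4\<close>, which the Picard-Fuchs equation \<open>L\<close> eliminates.\<close>

lemma period_identity_1: "K * (25 * h1 * (5 * e1 + 5 * e2 + c * e3) + 25 * h * (5 * e1' + 5 * e2' + c * e3' - 3125 * z * e3)) =
  - 125 * s0 ^ 6 + s0 ^ 4 * s1 + 125 * s0 * s4 + u^5 * s1 * s3"
  unfolding ds0 ds3 ds4 dK ds1 e c e' using u L[unfolded c] by algebra

lemma period_identity_2: "K * (- 10 * h * h1 * (5 * h + c * e2) - 5 * h^2 * (5 * h1 + c * e2' - 3125 * z * e2)) =
  - 1875 * s0 ^ 7 - u * s0 ^ 5 * s1 + 2 * s0 ^ 4 * s2 + 1875 * s0 ^ 2 * s4 + u * s1 * s4 + 2 * u^5 * s2 * s3"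
  unfolding ds0 ds3 ds4 dK ds1 ds2 e c e' using u by algebra

lemma period_identity_3: "K * (3 * h^2 * h1 * (- 5 * h + c * e1) + h^3 * (- 5 * h1 + c * e1' - 3125 * z * e1)) =
  - 3125 * s0 ^ 8 - u * s0 ^ 5 * s2 + 3 * s0 ^ 4 * s3 + 3125 * s0 ^ 3 * s4 + u * s2 * s4 + 3 * u^5 * s3 ^ 2"
  unfolding ds0 ds3 ds4 dK ds1 ds2 e c e' using u by algebra

lemma period_identity_4: "K * (z * h^5 + z * (5 * h^4 * h1)) = 5 * s0 ^ 4 * s4 + u^4 * s3 * s4"
  unfolding ds0 ds3 ds4 dK ds1 ds2 e c e' by algebra

text \<open>The equation for \<open>t 6\<close>, multiplied by \<open>t 5\<close>. The second
  derivative \<open>W2\<close> enters through \<open>s5''\<close> and is eliminated by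
  \<open>R\<close>.\<close>

lemma period_identity_6: "K * (K' * s5' + K * s5'') = (- 72 * u * s0 ^ 8 - 24 * u^5 * s0 ^ 4 * s3
                  - 3 * u * s0 ^ 3 * s4 - 2 * u^9 * s3 ^ 2) * s5 + s6 * (12 * s0 ^ 4 + 2 * u^4 * s3)"
proof -
  have "- 72 * u * s0 ^ 8 - 24 * u^5 * s0 ^ 4 * s3 - 3 * u * s0 ^ 3 * s4 - 2 * u^9 * s3 ^ 2
     = u^8 * (- 10 * h^6 * (625 * z * h - c * h1)^2 - 1875 * z * h^8)"
    unfolding ds0 ds3 ds4 e c using u by algebra
  moreover have "12 * s0 ^ 4 + 2 * u^4 * s3 = u^4 * (12 * h^4 + 2 * s3)"
    unfolding ds0 by algebra
  \<comment> \<open>With the powers of \<open>u\<close> split off, this is a polynomial identity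
    modulo the single relation \<open>R\<close>.\<close>
  moreover have "(- 1 * h^4 * c) * (((3125 * z) * h^4 - c * 4 * h^3 * h1) * ((3125 * z) * h^2 * W - c * 2 * h * h1 * W - c * h^2 * W1)
     - h^4 * c * ((3125 * z) * h^2 * W + 2 * ((3125 * z) * 2 * h * h1 * W + (3125 * z) * h^2 * W1) -
      c * 2 * (h1 * h1 * W + h * h2 * W + h * h1 * W1) - c * (2 * h * h1 * W1 + h^2 * W2))) = 
      (- 10 * h^6 * (625 * z * h - c * h1)^2 - 1875 * z * h^8) * (- (c * h^2 * W)) -
       (h^4 * c) * ((3125 * z) * h^2 * W - c * 2 * h * h1 * W - c * h^2 * W1) * (12 * h^4 + 2 * s3)"
    unfolding ds3 e c using R[unfolded c] by algebra
  ultimately show ?thesis unfolding dK dKp ds5 ds5p ds5pp ds6 apply simp by algebra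
qed

end

section \<open>The Euler operator and the series of the two periods\<close>

definition theta :: "complex fps \<Rightarrow> complex fps" where
  "theta f = fps_X * fps_deriv f"

lemma theta_nth: "fps_nth (theta f) n = of_nat n * fps_nth f n"
  by (cases n) (simp_all add: theta_def)

lemma theta_simps [simp]:
  "theta (f + g) = theta f + theta g" "theta (f - g) = theta f - theta g" "theta (- f) = - theta f"
  "theta (f * g) = theta f * g + f * theta g" "theta (f ^ n) = of_nat n * f ^ (n - 1) * theta f"
  "theta fps_X = fps_X" "theta (fps_const a) = 0" "theta (numeral k) = 0" "theta 1 = 0"
  by (simp_all add: theta_def algebra_simps fps_deriv_power flip: fps_of_nat)

lemma theta_eq_0D:
  assumes "theta f = 0" "fps_nth f 0 = 0"
  shows "f = 0"
proof (rule fps_ext)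
  show "fps_nth f n = fps_nth 0 n" for n
    using arg_cong[OF assms(1), of "\<lambda>f. fps_nth f n"] assms(2)
    by (cases n) (simp_all add: theta_nth del: of_nat_Suc)
qed

text \<open>The first period is \<open>per0\<close> and the second one \<open>log z \<cdot> per0 + per1\<close>, up to constants.\<close>

definition per0 :: "complex fps" where
  "per0 = Abs_fps (\<lambda>m. fact (5 * m) / fact m ^ 5)"

definition per1 :: "complex fps" where
  "per1 = Abs_fps (\<lambda>m. 5 * (fact (5 * m) / fact m ^ 5 * (\<Sum>k = m + 1..5 * m. 1 / of_nat k)))"

lemma per0_nth_0: "fps_nth per0 0 = 1"
  by (simp add: per0_def)

lemma per1_nth_0: "fps_nth per1 0 = 0"
  by (simp add: per1_def)

text \<open>The factor \<open>5 * m + 5\<close> of the factorial quotient cancels one of the five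
  factors \<open>m + 1\<close>, so the recurrence, and hence the differential equation, has order
  four.\<close>

lemma per0_nth_Suc:
  fixes m :: nat
  defines "x \<equiv> (of_nat m :: complex)"
  shows "(x + 1) ^ 4 * fps_nth per0 (Suc m) = 5 * (5*x+1) * (5*x+2) * (5*x+3) * (5*x+4) * fps_nth per0 m"
proof -
  define y where "y = x + 1"
  have f: "(fact (5 * Suc m) :: complex) = 5 * y * ((5*x+4) * (5*x+3) * (5*x+2) * (5*x+1)) * fact (5 * m)"
    unfolding x_def y_def by (simp add: fact_reduce algebra_simps)
  have g: "(fact (Suc m) :: complex) = y * fact m"
    unfolding x_def y_def by (simp add: add.commute)
  have nz: "y \<noteq> 0" unfolding x_def y_def by (metis of_nat_Suc of_nat_eq_0_iff add.commute Suc_not_Zero)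
  have "y ^ 4 * (5 * y * B * F / (y * G) ^ 5) = 5 * B * (F / G ^ 5)" for B F G :: complex
    using nz by (simp add: divide_simps power_mult_distrib power_numeral_reduce)
  from this[of "(5*x+4) * (5*x+3) * (5*x+2) * (5*x+1)" "fact (5 * m)" "fact m"] show ?thesis
    unfolding per0_def fps_nth_Abs_fps f g y_def[symmetric] by (simp add: mult_ac)
qed

lemma per1_nth:
  "fps_nth per1 m = 5 * fps_nth per0 m * (\<Sum>k = m + 1..5 * m. 1 / of_nat k)"
  by (simp add: per0_def per1_def)

lemma sum_inverse_Suc:
  fixes m :: nat
  defines "x \<equiv> (of_nat m :: complex)"
  shows "(\<Sum>k = Suc m + 1..5 * Suc m. 1 / of_nat k) = (\<Sum>k = m + 1..5 * m. 1 / of_nat k)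
    + 1/(5*x+1) + 1/(5*x+2) + 1/(5*x+3) + 1/(5*x+4) + 1/(5*x+5) - 1/(x+1)"
proof -
  have A: "(\<Sum>k = m + 1..5 * Suc m. 1 / of_nat k :: complex) =
     1/(x+1) + (\<Sum>k = Suc m + 1..5 * Suc m. 1 / of_nat k)"
    unfolding x_def by (subst sum.atLeast_Suc_atMost) (auto simp: add.commute)
  have e: "5 * Suc m = Suc (Suc (Suc (Suc (Suc (5 * m)))))" by simp
  have "(\<Sum>k = m + 1..5 * Suc m. 1 / of_nat k :: complex) = (\<Sum>k = m + 1..5 * m. 1 / of_nat k)
    + 1/(5*x+1) + 1/(5*x+2) + 1/(5*x+3) + 1/(5*x+4) + 1/(5*x+5)"
    unfolding e sum.cl_ivl_Suc x_def by (simp add: add_ac)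
  with A show ?thesis by (metis add_diff_cancel_left')
qed

lemma picard_fuchs_per0:
  "(1 - 3125 * fps_X) * theta (theta (theta (theta per0))) =
    fps_X * (6250 * theta (theta (theta per0)) + 4375 * theta (theta per0) + 1250 * theta per0 + 120 * per0)"
proof (rule fps_ext)
  fix n
  show "fps_nth ((1 - 3125 * fps_X) * theta (theta (theta (theta per0)))) n =
    fps_nth (fps_X * (6250 * theta (theta (theta per0)) + 4375 * theta (theta per0) + 1250 * theta per0 + 120 * per0)) n"
  proof (cases n)
    case (Suc m)
    show ?thesis
      using per0_nth_Suc[of m]
      by (simp add: left_diff_distrib mult.assoc theta_nth Suc) algebra
  qed (simp add: theta_nth left_diff_distrib mult.assoc)
qed

text \<open>The Picard-Fuchs equation for \<open>log z * per0 + per1\<close> with its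
  \<open>log z\<close> part removed. Applying \<theta> \<open>k\<close> times to
  \<open>log z * per0\<close> leaves \<open>k\<close> times the derivative of \<open>per0\<close> of
  order \<open>k - 1\<close>, whence the coefficients 4, 3, 2, 1.\<close>

lemma picard_fuchs_per1:
  "(1 - 3125 * fps_X) * (theta (theta (theta (theta per1))) + 4 * theta (theta (theta per0))) =
    fps_X * (6250 * (theta (theta (theta per1)) + 3 * theta (theta per0))
      + 4375 * (theta (theta per1) + 2 * theta per0) + 1250 * (theta per1 + per0) + 120 * per1)"
  (is "?l = ?r")
proof (rule fps_ext)
  fix n
  show "fps_nth ?l n = fps_nth ?r n"
  proof (cases n)
    case (Suc m)
    define x where "x = (of_nat m :: complex)"
    define S where "S = (\<Sum>k = m + 1..5 * m. 1 / of_nat k :: complex)"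
    have nz: "x + 1 \<noteq> 0" "5*x+1 \<noteq> 0" "5*x+2 \<noteq> 0" "5*x+3 \<noteq> 0" "5*x+4 \<noteq> 0"
      unfolding x_def using of_nat_eq_0_iff[where ?'a = complex, of "Suc m"]
        of_nat_eq_0_iff[where ?'a = complex, of "5 * m + 1"]
        of_nat_eq_0_iff[where ?'a = complex, of "5 * m + 2"]
        of_nat_eq_0_iff[where ?'a = complex, of "5 * m + 3"]
        of_nat_eq_0_iff[where ?'a = complex, of "5 * m + 4"] by (simp_all add: add.commute)
    \<comment> \<open>Both neighbouring coefficients of \<open>per0\<close> are polynomial multiples
      of \<open>a\<close>, so all denominators can be cleared.\<close>
    define a where "a = fps_nth per0 m / (x + 1) ^ 4"
    have a: "fps_nth per0 m = (x + 1) ^ 4 * a" using nz by (simp add: a_def)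
    have "(x + 1) ^ 4 * fps_nth per0 (Suc m) = (x + 1) ^ 4 * (5 * (5*x+1) * (5*x+2) * (5*x+3) * (5*x+4) * a)"
      using per0_nth_Suc[of m] unfolding x_def[symmetric] a by (simp add: mult_ac)
    hence a1: "fps_nth per0 (Suc m) = 5 * (5*x+1) * (5*x+2) * (5*x+3) * (5*x+4) * a"
      using nz by simp
    have S1: "(\<Sum>k = Suc m + 1..5 * Suc m. 1 / of_nat k) = S + 1/(5*x+1) + 1/(5*x+2) + 1/(5*x+3) + 1/(5*x+4) - 4/(5*(x+1))"
    proof -
      have "5 * x + 5 = 5 * (x + 1)" by simp
      with nz(1) have nz5: "5 * x + 5 \<noteq> 0" by (metis mult_eq_0_iff zero_neq_numeral)
      have "1/(5*x+5) - 1/(x+1) = - 4/(5*(x+1))"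
        using nz(1) nz5 by (simp add: divide_simps)
      thus ?thesis unfolding sum_inverse_Suc S_def x_def[symmetric] by simp
    qed
    have b1: "(x + 1) * fps_nth per1 (Suc m) = 5 * a * (5 * (x + 1) * ((5*x+1) * (5*x+2) * (5*x+3) * (5*x+4) * S
         + (5*x+2) * (5*x+3) * (5*x+4) + (5*x+1) * (5*x+3) * (5*x+4) + (5*x+1) * (5*x+2) * (5*x+4)
         + (5*x+1) * (5*x+2) * (5*x+3)) - 4 * (5*x+1) * (5*x+2) * (5*x+3) * (5*x+4))"
      unfolding per1_nth a1 S1 using nz
      by (simp add: divide_simps) algebra
    have b: "fps_nth per1 m = 5 * ((x + 1) ^ 4 * a) * S"
      unfolding per1_nth S_def a ..
    have y: "of_nat (Suc m) = x + 1" by (simp add: x_def)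
    show ?thesis
      unfolding Suc
      by (simp add: left_diff_distrib mult.assoc theta_nth a a1 b b1 y x_def[symmetric] del: of_nat_Suc) algebra
  qed (simp add: theta_nth left_diff_distrib mult.assoc)
qed


section \<open>The concomitant of the two solutions\<close>

text \<open>\<open>W\<close> is the Wronskian, with respect to \<theta>, of \<open>p\<close> and
  \<open>log z * p + g\<close>; the logarithms cancel in it. The relation combines the vanishing
  concomitant with a quadratic identity between minors.\<close>

lemma period_pairing_relation:
  defines "p \<equiv> per0" and "p1 \<equiv> theta per0" and "p2 \<equiv> theta (theta per0)" and "g \<equiv> per1"
  defines "c \<equiv> 1 - 3125 * fps_X :: complex fps"
  defines "W \<equiv> p * p + p * theta g - g * p1"
  shows "p * c * theta (theta W) = 2 * c * (p1 * theta W - p2 * W)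
    + p * fps_X * (3125 * theta W + 1250 * W)"
proof -
  define p3 p4 where "p3 = theta p2" and "p4 = theta p3"
  \<comment> \<open>\<open>gk\<close> is the part free of \<open>log z\<close> in the
    \<open>k\<close>-th derivative of \<open>log z * p + g\<close>. Differentiating it therefore
    yields the next one minus a derivative of \<open>p\<close>.\<close>
  define g1 g2 g3 g4 where "g1 = theta g + p" and "g2 = theta (theta g) + 2 * p1"
    and "g3 = theta (theta (theta g)) + 3 * p2" and "g4 = theta (theta (theta (theta g))) + 4 * p3"
  have th: "theta p = p1" "theta p1 = p2" "theta p2 = p3" "theta p3 = p4" "theta g = g1 - p"
    "theta g1 = g2 - p1" "theta g2 = g3 - p2" "theta g3 = g4 - p3"
    by (simp_all add: p_def p1_def p2_def p3_def p4_def g_def g1_def g2_def g3_def g4_def)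
  have L0: "c * p4 = fps_X * (6250 * p3 + 4375 * p2 + 1250 * p1 + 120 * p)"
    using picard_fuchs_per0 by (simp add: p_def p1_def p2_def p3_def p4_def c_def)
  have L1: "c * g4 = fps_X * (6250 * g3 + 4375 * g2 + 1250 * g1 + 120 * g)"
    using picard_fuchs_per1 by (simp add: p_def p1_def p2_def p3_def g_def g1_def g2_def g3_def g4_def c_def)
  have W: "W = p * g1 - p1 * g"
    by (simp add: W_def th algebra_simps)
  have W1: "theta W = p * g2 - p2 * g"
    by (simp add: W th algebra_simps)
  define S N where "S = p * g3 - p3 * g" and "N = p1 * g2 - p2 * g1"
  have W2: "theta (theta W) = S + N"
    by (simp add: W1 th S_def N_def algebra_simps)
  \<comment> \<open>The left-hand side is the concomitant of \<open>p\<close> and \<open>log z \<cdot> p + g\<close>.\<close>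
  have "c * (S - N) - fps_X * (3125 * theta W + 1250 * W) = 0"
  proof (rule theta_eq_0D)
    have tc: "theta c = - 3125 * fps_X" by (simp add: c_def)
    have tSN: "theta (S - N) = p * g4 - p4 * g"
      by (simp add: S_def N_def th algebra_simps)
    have e: "c * (p * g4 - p4 * g) = fps_X * (6250 * S + 4375 * theta W + 1250 * W)"
      using L0 L1 unfolding S_def W1 unfolding W by algebra
    have "theta (c * (S - N) - fps_X * (3125 * theta W + 1250 * W)) =
      theta c * (S - N) + c * theta (S - N) - fps_X * (3125 * (S + N) + 4375 * theta W + 1250 * W)"
      by (simp add: W2 algebra_simps)
    also have "\<dots> = 0" unfolding tc tSN e by algebra
    finally show "theta (c * (S - N) - fps_X * (3125 * theta W + 1250 * W)) = 0" .
    have "fps_nth p1 0 = 0" "fps_nth p2 0 = 0" "fps_nth p3 0 = 0" "fps_nth g2 0 = 0" "fps_nth g3 0 = 0"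
      by (simp_all add: p1_def p2_def p3_def g2_def g3_def theta_nth)
    thus "fps_nth (c * (S - N) - fps_X * (3125 * theta W + 1250 * W)) 0 = 0"
      by (simp add: S_def N_def)
  qed
  \<comment> \<open>The Pluecker relation between the 2x2 minors of \<open>(p, p1, p2)\<close> and
    \<open>(g, g1, g2)\<close>.\<close>
  moreover have "p * N = p1 * theta W - p2 * W"
    unfolding N_def W1 unfolding W by algebra
  ultimately show ?thesis
    unfolding W2 by algebra
qed

section \<open>The solution as power series in z\<close>

definition pairing :: "complex fps" where
  "pairing = per0 * per0 + per0 * theta per1 - per1 * theta per0"

text \<open>At \<open>z_tilde \<psi>\<close> this is \<open>1 - 1 / \<psi> ^ 5\<close>, the
  discriminant of the family.\<close>

definition disc :: "complex fps" where "disc = 1 - 3125 * fps_X"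

text \<open>\<open>kfac\<close> is \<open>5 t\<^sub>5 / \<theta> log q\<close>, so that \<open>t\<^sub>5 \<cdot> dot t\<close> corresponds to \<open>kfac \<cdot> \<theta> t\<close>.\<close>

definition kfac :: "complex fps" where "kfac = - (fps_const (1/5) ^ 4 * disc * per0 ^ 4)"

text \<open>\<open>psi1\<close>, \<open>psi2\<close>, \<open>psi3\<close> are \<open>(D - 1) h\<close>, \<open>(D - 1) (D - 2) h\<close>, \<open>(D - 1) (D - 2) (D - 3) h\<close> with
  \<open>D = \<psi> d/d\<psi> = - 5 \<theta>\<close>; they occur in the \<open>\<psi>\<close>-derivatives of \<open>h/\<psi>\<close>.\<close>

definition psi1 :: "complex fps" where "psi1 = -5 * theta per0 - per0"
definition psi2 :: "complex fps" where
  "psi2 = 25 * theta (theta per0) + 15 * theta per0 + 2 * per0"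
definition psi3 :: "complex fps" where
  "psi3 = -125 * theta (theta (theta per0)) - 150 * theta (theta per0) - 55 * theta per0 - 6 * per0"

definition wron :: "complex fps" where
  "wron = - (fps_const (1/5) ^ 5 * disc * per0 ^ 2 * pairing)"

text \<open>The claimed right-hand sides as series in \<open>z\<close>, where the powers of
  \<open>a\<close> and \<open>\<psi>\<close> have cancelled. The last entry encodes
  \<open>t 6 = t 5 * dot (t 5)\<close>.\<close>

definition zsol :: "nat \<Rightarrow> complex fps" where
  "zsol i = [fps_const (1/5) * per0,
     25 * per0 * (5 * psi1 + 5 * psi2 + disc * psi3),
     - 5 * per0 ^ 2 * (5 * per0 + disc * psi2),
     per0 ^ 3 * (- 5 * per0 + disc * psi1),
     fps_X * per0 ^ 5,
     wron,
     kfac * theta wron] ! i"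

lemma zsol_simps:
  "zsol 0 = fps_const (1/5) * per0"
  "zsol 1 = 25 * per0 * (5 * psi1 + 5 * psi2 + disc * psi3)"
  "zsol 2 = - 5 * per0 ^ 2 * (5 * per0 + disc * psi2)"
  "zsol 3 = per0 ^ 3 * (- 5 * per0 + disc * psi1)"
  "zsol 4 = fps_X * per0 ^ 5"
  "zsol 5 = wron"
  "zsol 6 = kfac * theta wron"
  by (simp_all add: zsol_def eval_nat_numeral)

text \<open>The cleared system with \<open>kfac * theta\<close> in place of
  \<open>t 5 * dot\<close>. The equation for \<open>t 5\<close> is the definition of
  \<open>zsol 6\<close>; the one for \<open>t 6\<close> appears multiplied by
  \<open>zsol 5\<close>.\<close>

lemma zsol_system:
  defines "u \<equiv> fps_const (1/5) :: complex fps"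
  shows "kfac * theta (zsol 0) = 6 * u * zsol 0 ^ 5 + u ^ 5 * zsol 0 * zsol 3 - u * zsol 4"
   (is ?E0)
    and "kfac * theta (zsol 1) = - 125 * zsol 0 ^ 6 + zsol 0 ^ 4 * zsol 1 + 125 * zsol 0 * zsol 4
      + u ^ 5 * zsol 1 * zsol 3" (is ?E1)
    and "kfac * theta (zsol 2) = - 1875 * zsol 0 ^ 7 - u * zsol 0 ^ 5 * zsol 1 + 2 * zsol 0 ^ 4 * zsol 2
      + 1875 * zsol 0 ^ 2 * zsol 4 + u * zsol 1 * zsol 4 + 2 * u ^ 5 * zsol 2 * zsol 3" (is ?E2)
    and "kfac * theta (zsol 3) = - 3125 * zsol 0 ^ 8 - u * zsol 0 ^ 5 * zsol 2 + 3 * zsol 0 ^ 4 * zsol 3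
      + 3125 * zsol 0 ^ 3 * zsol 4 + u * zsol 2 * zsol 4 + 3 * u ^ 5 * zsol 3 ^ 2" (is ?E3)
    and "kfac * theta (zsol 4) = 5 * zsol 0 ^ 4 * zsol 4 + u ^ 4 * zsol 3 * zsol 4" (is ?E4)
    and "kfac * theta (zsol 6) = (- 72 * u * zsol 0 ^ 8 - 24 * u ^ 5 * zsol 0 ^ 4 * zsol 3
      - 3 * u * zsol 0 ^ 3 * zsol 4 - 2 * u ^ 9 * zsol 3 ^ 2) * zsol 5
      + zsol 6 * (12 * zsol 0 ^ 4 + 2 * u ^ 4 * zsol 3)" (is ?E6)
proof -
  have 5: "5 * u = 1" by (simp add: u_def numeral_fps_const)
  have L: "disc * theta (theta (theta (theta per0))) = fps_X * (6250 * theta (theta (theta per0))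
    + 4375 * theta (theta per0) + 1250 * theta per0 + 120 * per0)"
    using picard_fuchs_per0 by (simp add: disc_def)
  have R: "per0 * disc * theta (theta pairing) =
    2 * disc * (theta per0 * theta pairing - theta (theta per0) * pairing)
    + per0 * fps_X * (3125 * theta pairing + 1250 * pairing)"
    using period_pairing_relation by (simp add: disc_def pairing_def)
  have tu: "theta u = 0" by (simp add: u_def)
  have td: "theta disc = - 3125 * fps_X" by (simp add: disc_def)
  have tk: "theta kfac = - 1 * u^4 * ((-3125 * fps_X) * per0^4 + disc * 4 * per0^3 * theta per0)"
    by (simp add: kfac_def[folded u_def] td tu algebra_simps)
  have tw: "theta wron = - 1 * u^5 * ((- 3125 * fps_X) * per0^2 * pairing + disc * 2 * per0 * theta per0 * pairing
      + disc * per0^2 * theta pairing)"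
    by (simp add: wron_def[folded u_def] td tu algebra_simps)
  have ttw: "theta (theta wron) = - 1 * u^5 * ((- 3125 * fps_X) * per0^2 * pairing
      + 2 * ((-3125 * fps_X) * 2 * per0 * theta per0 * pairing + (-3125 * fps_X) * per0^2 * theta pairing)
      + disc * 2 * (theta per0 * theta per0 * pairing + per0 * theta (theta per0) * pairing
        + per0 * theta per0 * theta pairing)
      + disc * (2 * per0 * theta per0 * theta pairing + per0^2 * theta (theta pairing)))"
    unfolding tw by (simp add: td tu algebra_simps)
  have tpsi: "theta psi1 = -5 * theta (theta per0) - theta per0"
    "theta psi2 = 25 * theta (theta (theta per0)) + 15 * theta (theta per0) + 2 * theta per0"
    "theta psi3 = -125 * theta (theta (theta (theta per0))) - 150 * theta (theta (theta per0))
      - 55 * theta (theta per0) - 6 * theta per0"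
    by (simp_all add: psi1_def psi2_def psi3_def)
  note D = 5 disc_def L R psi1_def psi2_def psi3_def tpsi
    zsol_simps(1-5)[folded u_def] kfac_def[folded u_def] wron_def[folded u_def] tw ttw tk zsol_simps(7)
  have "theta (zsol 0) = u * theta per0" by (simp add: zsol_simps u_def)
  with period_identity_0[OF D] show ?E0 by simp
  have "theta (zsol 1) = 25 * theta per0 * (5 * psi1 + 5 * psi2 + disc * psi3)
    + 25 * per0 * (5 * theta psi1 + 5 * theta psi2 + disc * theta psi3 - 3125 * fps_X * psi3)"
    by (simp add: zsol_simps td algebra_simps del: One_nat_def)
  with period_identity_1[OF D] show ?E1 by simp
  have "theta (zsol 2) = - 10 * per0 * theta per0 * (5 * per0 + disc * psi2)
    - 5 * per0^2 * (5 * theta per0 + disc * theta psi2 - 3125 * fps_X * psi2)"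
    by (simp add: zsol_simps td algebra_simps)
  with period_identity_2[OF D] show ?E2 by simp
  have "theta (zsol 3) = 3 * per0^2 * theta per0 * (- 5 * per0 + disc * psi1)
    + per0^3 * (- 5 * theta per0 + disc * theta psi1 - 3125 * fps_X * psi1)"
    by (simp add: zsol_simps td algebra_simps)
  with period_identity_3[OF D] show ?E3 by simp
  have "theta (zsol 4) = fps_X * per0^5 + fps_X * (5 * per0^4 * theta per0)"
    by (simp add: zsol_simps algebra_simps)
  with period_identity_4[OF D] show ?E4 by simp
  have "theta (zsol 6) = theta kfac * theta wron + kfac * theta (theta wron)"
    by (simp add: zsol_simps algebra_simps)
  with period_identity_6[OF D] show ?E6 by (simp add: zsol_simps(6))
qed

section \<open>The mirror map\<close>

definition nome :: "complex fps" where
  "nome = fps_X * (fps_exp 1 oo (per1 * inverse per0))"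

lemma nome_nth_0 [simp]: "fps_nth nome 0 = 0"
  by (simp add: nome_def)

lemma nome_nth_1 [simp]: "fps_nth nome (Suc 0) = 1"
  by (simp add: nome_def)

definition mirror :: "complex fps" where "mirror = fps_inv nome"

lemma mirror_nth_0 [simp]: "fps_nth mirror 0 = 0"
  by (simp add: mirror_def fps_inv_def)

lemma mirror_nth_1: "fps_nth mirror 1 = 1"
  by (simp add: mirror_def fps_inv_def)

lemma nome_compose_mirror: "nome oo mirror = fps_X"
  unfolding mirror_def by (rule fps_inv_right) simp_all

lemma mirror_compose_nome: "mirror oo nome = fps_X"
  unfolding mirror_def by (rule fps_inv) simp_all

text \<open>\<theta> applied to \<open>log q = log z + per1 / per0\<close>; the summand 1 comes from
  \<open>log z\<close>.\<close>

definition logder :: "complex fps" where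
  "logder = 1 + theta (per1 * inverse per0)"

lemma theta_nome: "theta nome = nome * logder"
proof -
  have "fps_deriv (fps_exp 1 oo (per1 * inverse per0)) =
    (fps_exp 1 oo (per1 * inverse per0)) * fps_deriv (per1 * inverse per0)"
    by (subst fps_compose_deriv) (simp_all add: per1_nth_0)
  thus ?thesis by (simp add: nome_def logder_def theta_def algebra_simps)
qed

text \<open>The quotient rule: the derivative of a ratio of two solutions is their Wronskian over
  the squared denominator.\<close>

lemma per0_sq_logder: "per0 ^ 2 * logder = pairing"
proof -
  define v where "v = per1 * inverse per0"
  have v: "per0 * v = per1"
    by (simp add: v_def per0_nth_0 inverse_mult_eq_1' mult.left_commute)
  have "theta per1 = theta per0 * v + per0 * theta v"
    unfolding v[symmetric] by simp
  thus ?thesis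
    unfolding logder_def pairing_def v_def[symmetric] using v by algebra
qed

lemma kfac_logder: "kfac * logder = 5 * wron"
proof -
  have "5 * fps_const (1/5) = (1 :: complex fps)" by (simp add: numeral_fps_const)
  thus ?thesis
    unfolding kfac_def wron_def per0_sq_logder[symmetric] by algebra
qed

text \<open>The chain rule for the change of variable from \<open>z\<close> to \<open>q\<close>,
  written without dividing by \<open>logder\<close>.\<close>

lemma dot_compose_mirror: "dot (f oo mirror) * (logder oo mirror) = 5 * (theta f oo mirror)"
proof -
  note cm = fps_compose_mult_distrib[OF mirror_nth_0, symmetric]
  have "fps_X * (fps_deriv nome oo mirror) * fps_deriv mirror = fps_X"
    using arg_cong[OF nome_compose_mirror, of fps_deriv]
    by (simp add: fps_compose_deriv mult.assoc)
  moreover have "mirror * (fps_deriv nome oo mirror) = fps_X * (logder oo mirror)"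
    using arg_cong[OF theta_nome, of "\<lambda>f. f oo mirror"]
    by (simp add: theta_def fps_compose_mult_distrib nome_compose_mirror)
  \<comment> \<open>Eliminates the derivative of \<open>nome\<close>; cancelling
    \<open>fps_X\<close> leaves \<open>mirror\<close> as a multiple of its own derivative.\<close>
  ultimately have "fps_X * mirror = fps_X * (fps_X * (logder oo mirror) * fps_deriv mirror)"
    by (simp add: algebra_simps) algebra
  hence "mirror = fps_X * (logder oo mirror) * fps_deriv mirror" by simp
  thus ?thesis
    by (simp add: dot_def theta_def fps_compose_mult_distrib fps_compose_deriv) algebra
qed

section \<open>The solution as power series in q\<close>

definition qsol :: "nat \<Rightarrow> complex fps" where
  "qsol i = zsol i oo mirror"

lemma wron_nth_0: "fps_nth wron 0 = -1/3125"
  by (simp add: wron_def disc_def pairing_def per0_nth_0 per1_nth_0 theta_nth fps_nth_power_0 power_numeral_reduce)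

lemma qsol_initial:
  "fps_nth (qsol 0) 0 = 1/5" "fps_nth (qsol 0) 1 = 24" "fps_nth (qsol 4) 0 = 0" "fps_nth (qsol 5) 0 \<noteq> 0"
proof -
  show "fps_nth (qsol 0) 0 = 1/5" "fps_nth (qsol 4) 0 = 0" "fps_nth (qsol 5) 0 \<noteq> 0"
    by (simp_all add: qsol_def zsol_simps per0_nth_0 wron_nth_0)
  have "fps_nth per0 1 = 120" by (simp add: per0_def fact_numeral)
  thus "fps_nth (qsol 0) 1 = 24"
    using mirror_nth_1 by (simp add: qsol_def zsol_simps fps_compose_nth)
qed

lemma qsol_dot: "qsol 5 * dot (qsol i) = (kfac * theta (zsol i)) oo mirror"
proof -
  have "5 * qsol 5 = (kfac oo mirror) * (logder oo mirror)"
    using arg_cong[OF kfac_logder, of "\<lambda>f. f oo mirror"]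
    by (simp add: qsol_def zsol_simps fps_compose_mult_distrib numeral_fps_const)
  hence "5 * (qsol 5 * dot (qsol i)) = 5 * ((kfac * theta (zsol i)) oo mirror)"
    using dot_compose_mirror[of "zsol i"]
    unfolding qsol_def[of i] fps_compose_mult_distrib[OF mirror_nth_0] by algebra
  thus ?thesis by simp
qed

lemma qsol_system: "cleared_system qsol"
proof -
  define u :: "complex fps" where "u = fps_const (1/5)"
  have c: "fps_const (6/5) = 6 * u" "fps_const (1/3125) = u^5" "fps_const (1/5) = u"
    "fps_const (2/3125) = 2 * u^5" "fps_const (3/3125) = 3 * u^5" "fps_const (1/625) = u^4"
    "fps_const (72/5) = 72 * u" "fps_const (24/3125) = 24 * u^5" "fps_const (3/5) = 3 * u"
    "fps_const (2/1953125) = 2 * u^9" "fps_const (2/625) = 2 * u^4"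
    by (simp_all add: u_def numeral_fps_const fps_const_power power_divide)
  have u: "u oo mirror = u" by (simp add: u_def)
  have num: "numeral k oo mirror = numeral k" for k by (simp add: numeral_fps_const)
  note comp = fps_compose_mult_distrib[OF mirror_nth_0] fps_compose_add_distrib
    fps_compose_sub_distrib fps_compose_power[OF mirror_nth_0, symmetric]
    num u fps_compose_uminus qsol_def[symmetric]
  note Z = zsol_system[folded u_def, THEN arg_cong[of _ _ "\<lambda>f. f oo mirror"], folded qsol_dot]
  have E5: "qsol 5 * dot (qsol 5) = qsol 6"
    using qsol_dot[of 5] by (simp add: zsol_simps qsol_def)
  \<comment> \<open>\<open>zsol_system\<close> yields the equation for \<open>t 6\<close> only after
    multiplication by \<open>qsol 5\<close>; power series form a domain, so the factor
    cancels.\<close>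
  have "qsol 5 * dot (qsol 6) = qsol 5 * ((- (72 * u) * qsol 0 ^ 8 - 24 * u^5 * qsol 0 ^ 4 * qsol 3
                  - 3 * u * qsol 0 ^ 3 * qsol 4 - 2 * u^9 * qsol 3 ^ 2)
                 + dot (qsol 5) * (12 * qsol 0 ^ 4 + 2 * u^4 * qsol 3))"
    using Z(6) unfolding comp E5[symmetric] by algebra
  moreover have "qsol 5 \<noteq> 0" using qsol_initial(4) by auto
  ultimately have E6: "dot (qsol 6) = (- (72 * u) * qsol 0 ^ 8 - 24 * u^5 * qsol 0 ^ 4 * qsol 3
                  - 3 * u * qsol 0 ^ 3 * qsol 4 - 2 * u^9 * qsol 3 ^ 2)
                 + dot (qsol 5) * (12 * qsol 0 ^ 4 + 2 * u^4 * qsol 3)"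
    by simp
  show ?thesis
    unfolding cleared_system_def c
    using Z(1-5)[unfolded comp] E5 E6 by blast
qed

section \<open>Convergence\<close>

lemma fact_mult_le:
  "fact (5 * m) \<le> (3125 ^ m * fact m ^ 5 :: real)"
proof (induction m)
  case (Suc m)
  define x where "x = real m"
  have "fact (5 * Suc m) = ((5*x+5) * (5*x+4) * (5*x+3) * (5*x+2) * (5*x+1)) * (fact (5 * m) :: real)"
    unfolding x_def by (simp add: fact_reduce algebra_simps)
  also have "\<dots> \<le> ((5*x+5) * (5*x+5) * (5*x+5) * (5*x+5) * (5*x+5)) * (3125 ^ m * fact m ^ 5)"
    using Suc unfolding x_def by (intro mult_mono mult_nonneg_nonneg) auto
  also have "\<dots> = 3125 ^ Suc m * fact (Suc m) ^ 5"
    unfolding x_def by (simp add: power_mult_distrib power_numeral_reduce) (simp add: algebra_simps)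
  finally show ?case .
qed simp

lemma norm_per0_nth: "norm (fps_nth per0 m) = fact (5 * m) / fact m ^ 5"
  by (simp add: per0_def norm_divide norm_power)

lemma fps_conv_radius_posI:
  fixes f :: "complex fps"
  assumes bound: "\<And>n. norm (fps_nth f n) \<le> C * K ^ n" and K: "K > 0"
  shows "fps_conv_radius f > 0"
proof -
  \<comment> \<open>At half the radius suggested by \<open>K\<close> the terms are dominated by a
    geometric series of ratio \<open>1/2\<close>.\<close>
  let ?z = "of_real (1 / (2 * K)) :: complex"
  have nz: "norm ?z = 1 / (2 * K)"
    by (subst norm_of_real) (use K in simp)
  have "summable (\<lambda>n. fps_nth f n * ?z ^ n)"
  proof (rule summable_comparison_test')
    show "summable (\<lambda>n. C * (1/2) ^ n :: real)"
      by (intro summable_mult summable_geometric) simp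
    show "norm (fps_nth f n * ?z ^ n) \<le> C * (1/2) ^ n" if "n \<ge> 0" for n
    proof -
      have "norm (fps_nth f n * ?z ^ n) \<le> (C * K ^ n) * (1 / (2 * K)) ^ n"
        unfolding norm_mult norm_power nz using K order_trans[OF norm_ge_zero bound]
        by (intro mult_mono bound) auto
      also have "\<dots> = C * (1/2) ^ n" using K by (simp add: power_divide power_mult_distrib)
      finally show ?thesis .
    qed
  qed
  hence "fps_conv_radius f \<ge> norm ?z"
    unfolding fps_conv_radius_def by (rule conv_radius_geI)
  moreover have "norm ?z > 0" using K by simp
  ultimately show ?thesis by (metis ereal_less(2) less_le_trans)
qed

lemma norm_per0_nth_le: "norm (fps_nth per0 m) \<le> 3125 ^ m"
  unfolding norm_per0_nth using fact_mult_le[of m] by (simp add: divide_simps)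

lemma conv_radius_per0: "fps_conv_radius per0 > 0"
  using fps_conv_radius_posI[of per0 1 3125] norm_per0_nth_le by simp

lemma conv_radius_per1: "fps_conv_radius per1 > 0"
proof (rule fps_conv_radius_posI)
  \<comment> \<open>The harmonic sum has \<open>4 * m\<close> terms of norm at most 1 and
    \<open>m < 2 ^ m\<close>, which gives \<open>20 = 5 * 4\<close> and
    \<open>6250 = 3125 * 2\<close>.\<close>
  show "norm (fps_nth per1 m) \<le> 20 * 6250 ^ m" for m
  proof -
    have "norm (\<Sum>k = m + 1..5 * m. 1 / of_nat k :: complex) \<le> (\<Sum>k = m + 1..5 * m. 1)"
      by (intro sum_norm_le) (simp add: norm_divide)
    also have "\<dots> \<le> 4 * 2 ^ m"
      using less_exp[of m] by (simp flip: of_nat_power)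
    finally have "norm (fps_nth per1 m) \<le> 5 * 3125 ^ m * (4 * 2 ^ m)"
      unfolding per1_nth norm_mult using norm_per0_nth_le[of m] by (intro mult_mono) auto
    thus ?thesis by (simp flip: power_mult_distrib)
  qed
qed simp

text \<open>With a general lower bound \<open>x\<close> these rules serve both positivity of the
  radius and evaluation at a given point.\<close>

lemma conv_radius_less_intros:
  fixes f g :: "complex fps"
  shows "x < fps_conv_radius f \<Longrightarrow> x < fps_conv_radius g \<Longrightarrow> x < fps_conv_radius (f + g)"
    "x < fps_conv_radius f \<Longrightarrow> x < fps_conv_radius g \<Longrightarrow> x < fps_conv_radius (f - g)"
    "x < fps_conv_radius f \<Longrightarrow> x < fps_conv_radius g \<Longrightarrow> x < fps_conv_radius (f * g)"
    "x < fps_conv_radius f \<Longrightarrow> x < fps_conv_radius (f ^ n)"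
    "x < fps_conv_radius f \<Longrightarrow> x < fps_conv_radius (theta f)"
proof -
  show A: "x < fps_conv_radius f \<Longrightarrow> x < fps_conv_radius g \<Longrightarrow> x < fps_conv_radius (f * g)"
    for f g :: "complex fps"
    by (rule less_le_trans[OF _ fps_conv_radius_mult]) simp
  show "x < fps_conv_radius f \<Longrightarrow> x < fps_conv_radius g \<Longrightarrow> x < fps_conv_radius (f + g)"
    by (rule less_le_trans[OF _ fps_conv_radius_add]) simp
  show "x < fps_conv_radius f \<Longrightarrow> x < fps_conv_radius g \<Longrightarrow> x < fps_conv_radius (f - g)"
    by (rule less_le_trans[OF _ fps_conv_radius_diff]) simp
  show "x < fps_conv_radius f \<Longrightarrow> x < fps_conv_radius (f ^ n)"
    by (rule less_le_trans[OF _ fps_conv_radius_power])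
  assume x: "x < fps_conv_radius f"
  hence "x < \<infinity>" by (rule less_le_trans) simp
  with x show "x < fps_conv_radius (theta f)"
    unfolding theta_def by (intro A less_le_trans[OF x fps_conv_radius_deriv]) simp_all
qed

text \<open>A holomorphic local inverse exists because the derivative at 0 is non-zero. Its
  expansion is a left compositional inverse of \<open>f\<close>, hence equal to the formal
  inverse.\<close>

lemma fps_conv_radius_inv_pos:
  fixes f :: "complex fps"
  assumes f0: "fps_nth f 0 = 0" and f1: "fps_nth f 1 \<noteq> 0" and conv: "fps_conv_radius f > 0"
  shows "fps_conv_radius (fps_inv f) > 0"
proof -
  let ?S = "eball (0::complex) (fps_conv_radius f)"
  have hol: "eval_fps f holomorphic_on ?S" by (intro holomorphic_intros) auto
  have zero: "0 \<in> ?S" using conv by (simp add: zero_ereal_def)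
  have der: "deriv (eval_fps f) 0 \<noteq> 0"
    using fps_nth_conv_deriv[OF conv, of 1] f1 by simp
  obtain r where r: "r > 0" "ball 0 r \<subseteq> ?S" "open (eval_fps f ` ball 0 r)"
      "inj_on (eval_fps f) (ball 0 r)"
    by (rule has_complex_derivative_locally_invertible[OF hol zero open_eball der]) (rule that)
  obtain g where g: "g holomorphic_on (eval_fps f ` ball 0 r)"
      "\<And>z. z \<in> ball 0 r \<Longrightarrow> g (eval_fps f z) = z"
    by (rule holomorphic_has_inverse[OF holomorphic_on_subset[OF hol r(2)] open_ball r(4)]) auto
  have "0 \<in> eval_fps f ` ball 0 r"
    using r(1) f0 by (intro image_eqI[of _ _ 0]) (simp_all add: eval_fps_at_0)
  hence G: "g has_fps_expansion fps_expansion g 0"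
    using g(1) r(3) by blast
  have E1: "(g \<circ> eval_fps f) has_fps_expansion (fps_expansion g 0 oo f)"
    by (intro has_fps_expansion_compose G eval_fps_has_fps_expansion conv f0)
  have "eventually (\<lambda>z. (g \<circ> eval_fps f) z = z) (nhds 0)"
    unfolding eventually_nhds by (rule exI[of _ "ball 0 r"]) (use r(1) g(2) in auto)
  hence E2: "(g \<circ> eval_fps f) has_fps_expansion fps_X"
    using has_fps_expansion_fps_X by (subst has_fps_expansion_cong[OF _ refl, of _ "\<lambda>z. z"]) auto
  have "fps_expansion g 0 oo f = fps_X"
    by (rule fps_expansion_unique_complex[OF E1 E2])
  also have "\<dots> = fps_inv f oo f" by (rule fps_inv[OF f0 f1, symmetric])
  finally have "fps_expansion g 0 = fps_inv f"
    using fps_compose_inj_right[OF f0 f1] by blast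
  with G show ?thesis by (simp add: has_fps_expansion_def)
qed

lemma nome_expansion:
  "(\<lambda>z. z * exp (eval_fps per1 z / eval_fps per0 z)) has_fps_expansion nome"
proof -
  have "(\<lambda>z. eval_fps per1 z * inverse (eval_fps per0 z)) has_fps_expansion (per1 * inverse per0)"
    by (intro fps_expansion_intros eval_fps_has_fps_expansion conv_radius_per0 conv_radius_per1)
       (simp add: per0_nth_0)
  hence "(exp \<circ> (\<lambda>z. eval_fps per1 z * inverse (eval_fps per0 z))) has_fps_expansion
      (fps_exp 1 oo (per1 * inverse per0))"
    by (intro has_fps_expansion_compose has_fps_expansion_exp1) (simp_all add: per1_nth_0)
  from has_fps_expansion_mult[OF has_fps_expansion_fps_X this] show ?thesis
    by (simp add: nome_def o_def divide_inverse)
qed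

lemma conv_radius_nome: "fps_conv_radius nome > 0"
  using nome_expansion by (simp add: has_fps_expansion_def)

lemma conv_radius_mirror: "fps_conv_radius mirror > 0"
  unfolding mirror_def by (rule fps_conv_radius_inv_pos) (simp_all add: conv_radius_nome)

lemma conv_radius_wron: "x < fps_conv_radius per0 \<Longrightarrow> x < fps_conv_radius per1 \<Longrightarrow> x < \<infinity> \<Longrightarrow> x < fps_conv_radius wron"
  unfolding wron_def pairing_def disc_def
  by (simp add: conv_radius_less_intros)

lemma conv_radius_zsol:
  assumes "i \<le> 6"
  shows "fps_conv_radius (zsol i) > 0"
proof -
  have "i = 0 \<or> i = 1 \<or> i = 2 \<or> i = 3 \<or> i = 4 \<or> i = 5 \<or> i = 6" using assms by arith
  thus ?thesis
    using conv_radius_per0 conv_radius_per1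
    by (auto simp: zsol_simps kfac_def disc_def psi1_def psi2_def psi3_def conv_radius_wron simp del: One_nat_def
        intro!: conv_radius_less_intros)
qed

text \<open>The formal identity \<open>qsol i oo nome = zsol i\<close> passes to functions near 0
  since all series involved converge; continuity at 0 keeps the value of \<open>nome\<close> inside
  the disc of convergence.\<close>

lemma qsol_expansion:
  assumes "i \<le> 6"
  shows "fps_conv_radius (qsol i) > 0"
    and "eventually (\<lambda>z. eval_fps (qsol i) (eval_fps nome z) = eval_fps (zsol i) z) (nhds 0)"
    and "eventually (\<lambda>z. ereal (norm (eval_fps nome z)) < fps_conv_radius (qsol i)) (nhds 0)"
proof -
  have "(eval_fps (zsol i) \<circ> eval_fps mirror) has_fps_expansion qsol i"
    unfolding qsol_def using conv_radius_zsol[OF assms] conv_radius_mirror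
    by (intro has_fps_expansion_compose eval_fps_has_fps_expansion) simp_all
  thus conv: "fps_conv_radius (qsol i) > 0" by (simp add: has_fps_expansion_def)
  have "(eval_fps (qsol i) \<circ> eval_fps nome) has_fps_expansion (qsol i oo nome)"
    using conv conv_radius_nome
    by (intro has_fps_expansion_compose eval_fps_has_fps_expansion) simp_all
  also have "qsol i oo nome = zsol i"
    unfolding qsol_def by (simp add: fps_compose_assoc[symmetric] mirror_compose_nome)
  finally show "eventually (\<lambda>z. eval_fps (qsol i) (eval_fps nome z) = eval_fps (zsol i) z) (nhds 0)"
    by (simp add: has_fps_expansion_def eq_commute[of "eval_fps (zsol i) _"])
  have "(eval_fps nome \<longlongrightarrow> eval_fps nome 0) (nhds 0)"
    using has_fps_expansion_imp_continuous[OF eval_fps_has_fps_expansion[OF conv_radius_nome], of UNIV]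
    by (simp add: isCont_def tendsto_at_iff_tendsto_nhds)
  moreover have "eval_fps nome 0 \<in> eball 0 (fps_conv_radius (qsol i))"
    using conv by (simp add: eval_fps_at_0 zero_ereal_def)
  ultimately have "eventually (\<lambda>z. eval_fps nome z \<in> eball 0 (fps_conv_radius (qsol i))) (nhds 0)"
    by (intro topological_tendstoD) auto
  thus "eventually (\<lambda>z. ereal (norm (eval_fps nome z)) < fps_conv_radius (qsol i)) (nhds 0)"
    by (simp add: dist_norm)
qed


text \<open>The shape of a period is stable under differentiation: \<open>\<psi> d/d\<psi>\<close>
  acts as \<open>-5 \<theta>\<close> on series in \<open>z_tilde \<psi>\<close> and sends the
  logarithm to -5, which is the source of \<open>- 5 * A\<close>.\<close>

lemma deriv_period_form:
  assumes "open U" "\<psi> \<in> U"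
    and nz: "\<And>\<psi>. \<psi> \<in> U \<Longrightarrow> \<psi> \<noteq> 0"
    and A: "\<And>\<psi>. \<psi> \<in> U \<Longrightarrow> norm (z_tilde \<psi>) < fps_conv_radius A"
    and B: "\<And>\<psi>. \<psi> \<in> U \<Longrightarrow> norm (z_tilde \<psi>) < fps_conv_radius B"
    and L: "\<And>\<psi>. \<psi> \<in> U \<Longrightarrow> (L has_field_derivative - 5 / \<psi>) (at \<psi>)"
    and f: "\<And>\<psi>. \<psi> \<in> U \<Longrightarrow>
      f \<psi> = c * (L \<psi> * eval_fps A (z_tilde \<psi>) + eval_fps B (z_tilde \<psi>)) / \<psi> ^ Suc k"
  defines "D \<equiv> \<lambda>P. - 5 * theta P - of_nat (Suc k) * P"
  shows "deriv f \<psi> = c * (L \<psi> * eval_fps (D A) (z_tilde \<psi>) + eval_fps (D B - 5 * A) (z_tilde \<psi>)) / \<psi> ^ Suc (Suc k)"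
proof -
  define z where "z = z_tilde \<psi>"
  have psi: "\<psi> \<noteq> 0" using nz assms(2) by blast
  have z: "(z_tilde has_field_derivative - 5 * z / \<psi>) (at \<psi>)"
    unfolding z_def z_tilde_def[abs_def] using psi
    by (auto intro!: derivative_eq_intros simp: field_simps power_numeral_reduce)
  have A': "norm z < fps_conv_radius A" and B': "norm z < fps_conv_radius B"
    using A B assms(2) by (auto simp: z_def)
  have e: "((\<lambda>\<psi>. eval_fps P (z_tilde \<psi>)) has_field_derivative eval_fps (fps_deriv P) z * (- 5 * z / \<psi>)) (at \<psi>)"
    if "norm z < fps_conv_radius P" for P
    using DERIV_chain2[OF has_field_derivative_eval_fps z] that by (simp add: z_def)
  have "deriv f \<psi> = deriv (\<lambda>\<psi>. c * (L \<psi> * eval_fps A (z_tilde \<psi>) + eval_fps B (z_tilde \<psi>)) / \<psi> ^ Suc k) \<psi>"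
    by (intro deriv_cong_ev refl eventually_mono[OF eventually_nhds_in_open[OF assms(1,2)]] f)
  also have "\<dots> = c * (L \<psi> * eval_fps (D A) z + eval_fps (D B - 5 * A) z) / \<psi> ^ Suc (Suc k)"
  proof (rule DERIV_imp_deriv)
    have ev: "eval_fps (D P) z = - 5 * (z * eval_fps (fps_deriv P) z) - of_nat (Suc k) * eval_fps P z"
      if "norm z < fps_conv_radius P" for P
      unfolding D_def theta_def
      using that less_le_trans[OF that fps_conv_radius_deriv]
      by (simp add: eval_fps_diff eval_fps_minus eval_fps_mult conv_radius_less_intros flip: fps_of_nat)
    have ev2: "eval_fps (D B - 5 * A) z = eval_fps (D B) z - 5 * eval_fps A z"
      unfolding D_def using A' B'
      by (subst eval_fps_diff) (simp_all add: eval_fps_mult conv_radius_less_intros flip: fps_of_nat)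
    show "((\<lambda>\<psi>. c * (L \<psi> * eval_fps A (z_tilde \<psi>) + eval_fps B (z_tilde \<psi>)) / \<psi> ^ Suc k)
      has_field_derivative c * (L \<psi> * eval_fps (D A) z + eval_fps (D B - 5 * A) z) / \<psi> ^ Suc (Suc k)) (at \<psi>)"
      unfolding ev2 ev[OF A'] ev[OF B']
      apply (rule DERIV_cong[OF DERIV_divide[OF DERIV_cmult[OF
          DERIV_add[OF DERIV_mult[OF L[OF assms(2)] e[OF A']] e[OF B']]] DERIV_power[OF DERIV_ident]]])
      using psi apply (simp_all add: z_def[symmetric])
      apply (simp add: divide_simps)
      by algebra
  qed
  finally show ?thesis by (simp only: z_def)
qed

section \<open>Derivatives of the periods\<close>

text \<open>The parts free of the logarithm in the first and second \<psi>-derivatives of the second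
  period, accompanying \<open>L * psi1\<close> and \<open>L * psi2\<close>.\<close>

definition log1 :: "complex fps" where "log1 = - 5 * theta per1 - per1 - 5 * per0"
definition log2 :: "complex fps" where "log2 = - 5 * theta log1 - 2 * log1 - 5 * psi1"

lemma h0_eq: "h0 = eval_fps per0"
  by (rule ext) (simp add: h0_def eval_fps_def per0_def)

lemma h1_eq:
  assumes "norm z < fps_conv_radius per1"
  shows "h1 l z = l * eval_fps per0 z + eval_fps per1 z"
proof -
  let ?f = "\<lambda>m. fact (5 * m) / fact m ^ 5 * (\<Sum>k = m + 1..5 * m. 1 / of_nat k) * z ^ m"
  have e: "fps_nth per1 m * z ^ m = 5 * ?f m" for m by (simp add: per1_def)
  have "summable (\<lambda>m. 5 * ?f m)" using summable_fps[OF assms] unfolding e .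
  hence "summable ?f" by (simp only: summable_cmult_iff) simp
  hence "(\<Sum>m. 5 * ?f m) = 5 * suminf ?f" by (rule suminf_mult)
  thus ?thesis unfolding h1_def h0_eq eval_fps_def[of per1] e by simp
qed

lemma log_branch_deriv:
  assumes "open U" "log_branch U L" "\<psi> \<in> U" "\<psi> \<noteq> 0"
  shows "(L has_field_derivative - 5 / \<psi>) (at \<psi>)"
proof -
  have L: "(L has_field_derivative deriv L \<psi>) (at \<psi>)"
    using assms holomorphic_derivI unfolding log_branch_def by blast
  have "((\<lambda>\<psi>. exp (L \<psi>)) has_field_derivative exp (L \<psi>) * deriv L \<psi>) (at \<psi>)"
    by (rule DERIV_fun_exp[OF L])
  moreover have "((\<lambda>\<psi>. exp (L \<psi>)) has_field_derivative - 5 * z_tilde \<psi> / \<psi>) (at \<psi>)"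
  proof (rule has_field_derivative_transform_within_open)
    show "(z_tilde has_field_derivative - 5 * z_tilde \<psi> / \<psi>) (at \<psi>)"
      unfolding z_tilde_def[abs_def] using assms(4)
      by (auto intro!: derivative_eq_intros simp: field_simps power_numeral_reduce)
  qed (use assms in \<open>auto simp: log_branch_def\<close>)
  ultimately have "exp (L \<psi>) * deriv L \<psi> = - 5 * z_tilde \<psi> / \<psi>"
    by (rule DERIV_unique)
  moreover have "exp (L \<psi>) = z_tilde \<psi>" using assms by (auto simp: log_branch_def)
  ultimately have "exp (L \<psi>) * deriv L \<psi> = exp (L \<psi>) * (- 5 / \<psi>)" by simp
  hence "deriv L \<psi> = - 5 / \<psi>" unfolding mult_left_cancel[OF exp_not_eq_zero] .
  with L show ?thesis by simp
qed

context
  fixes U :: "complex set" and L :: "complex \<Rightarrow> complex" and a :: complex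
  assumes U: "open U" and L: "log_branch U L"
    and nz: "\<And>\<psi>. \<psi> \<in> U \<Longrightarrow> \<psi> \<noteq> 0"
    and conv0: "\<And>\<psi>. \<psi> \<in> U \<Longrightarrow> norm (z_tilde \<psi>) < fps_conv_radius per0"
    and conv1: "\<And>\<psi>. \<psi> \<in> U \<Longrightarrow> norm (z_tilde \<psi>) < fps_conv_radius per1"
  defines "a \<equiv> 2 * of_real pi * \<i> / 5"
begin

lemma branch_deriv: "\<psi> \<in> U \<Longrightarrow> (L has_field_derivative - 5 / \<psi>) (at \<psi>)"
  using log_branch_deriv[OF U L] nz by blast

lemma conv_psi:
  assumes "\<psi> \<in> U"
  shows "norm (z_tilde \<psi>) < fps_conv_radius psi1" "norm (z_tilde \<psi>) < fps_conv_radius psi2"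
    "norm (z_tilde \<psi>) < fps_conv_radius psi3"
    "norm (z_tilde \<psi>) < fps_conv_radius log1" "norm (z_tilde \<psi>) < fps_conv_radius log2"
  using conv0[OF assms] conv1[OF assms]
  by (simp_all add: psi1_def psi2_def psi3_def log1_def log2_def conv_radius_less_intros)

lemma x1_values:
  assumes "\<psi> \<in> U"
  shows "x1 1 \<psi> = a ^ 3 / 5 * eval_fps per0 (z_tilde \<psi>) / \<psi>"
    and "x1 2 \<psi> = a ^ 3 / 5 * eval_fps psi1 (z_tilde \<psi>) / \<psi> ^ 2"
    and "x1 3 \<psi> = a ^ 3 / 5 * eval_fps psi2 (z_tilde \<psi>) / \<psi> ^ 3"
    and "x1 4 \<psi> = a ^ 3 / 5 * eval_fps psi3 (z_tilde \<psi>) / \<psi> ^ 4"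
proof -
  \<comment> \<open>The first period has the zero series as coefficient of the logarithm; its
    constant is \<open>a ^ 3 / 5\<close> because \<open>2 * pi * \<i> = 5 * a\<close>.\<close>
  let ?form = "\<lambda>P k \<psi>. a ^ 3 / 5 * (L \<psi> * eval_fps 0 (z_tilde \<psi>) + eval_fps P (z_tilde \<psi>)) / \<psi> ^ Suc k"
  have step: "x1 (Suc (Suc k)) \<psi> = ?form (- 5 * theta P - of_nat (Suc k) * P) (Suc k) \<psi>"
    if "\<And>\<psi>. \<psi> \<in> U \<Longrightarrow> x1 (Suc k) \<psi> = ?form P k \<psi>"
      "\<And>\<psi>. \<psi> \<in> U \<Longrightarrow> norm (z_tilde \<psi>) < fps_conv_radius P" "\<psi> \<in> U" for k P \<psi>
    using deriv_period_form[OF U that(3) nz _ that(2) branch_deriv that(1)]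
    by (simp add: x1_def theta_def)
  have 1: "x1 (Suc 0) \<psi> = ?form per0 0 \<psi>" if "\<psi> \<in> U" for \<psi>
    by (simp add: x1_def period1_def h0_eq a_def power_divide)
  have 2: "x1 (Suc (Suc 0)) \<psi> = ?form psi1 (Suc 0) \<psi>" if "\<psi> \<in> U" for \<psi>
    using step[OF 1 conv0 that] by (simp add: psi1_def)
  have "psi2 = - 5 * theta psi1 - of_nat (Suc (Suc 0)) * psi1"
    by (simp add: psi1_def psi2_def)
  hence 3: "x1 (Suc (Suc (Suc 0))) \<psi> = ?form psi2 (Suc (Suc 0)) \<psi>" if "\<psi> \<in> U" for \<psi>
    using step[OF 2 conv_psi(1) that] by simp
  have "psi3 = - 5 * theta psi2 - of_nat (Suc (Suc (Suc 0))) * psi2"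
    by (simp add: psi2_def psi3_def)
  hence 4: "x1 (Suc (Suc (Suc (Suc 0)))) \<psi> = ?form psi3 (Suc (Suc (Suc 0))) \<psi>" if "\<psi> \<in> U" for \<psi>
    using step[OF 3 conv_psi(2) that] by simp
  show "x1 1 \<psi> = a ^ 3 / 5 * eval_fps per0 (z_tilde \<psi>) / \<psi>"
    "x1 2 \<psi> = a ^ 3 / 5 * eval_fps psi1 (z_tilde \<psi>) / \<psi> ^ 2"
    "x1 3 \<psi> = a ^ 3 / 5 * eval_fps psi2 (z_tilde \<psi>) / \<psi> ^ 3"
    "x1 4 \<psi> = a ^ 3 / 5 * eval_fps psi3 (z_tilde \<psi>) / \<psi> ^ 4"
    using 1[OF assms] 2[OF assms] 3[OF assms] 4[OF assms] by (simp_all add: eval_nat_numeral)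
qed

lemma x2_values:
  assumes "\<psi> \<in> U"
  shows "x2 L 1 \<psi> = a ^ 2 / 25 * (L \<psi> * eval_fps per0 (z_tilde \<psi>) + eval_fps per1 (z_tilde \<psi>)) / \<psi>"
    and "x2 L 2 \<psi> = a ^ 2 / 25 * (L \<psi> * eval_fps psi1 (z_tilde \<psi>) + eval_fps log1 (z_tilde \<psi>)) / \<psi> ^ 2"
    and "x2 L 3 \<psi> = a ^ 2 / 25 * (L \<psi> * eval_fps psi2 (z_tilde \<psi>) + eval_fps log2 (z_tilde \<psi>)) / \<psi> ^ 3"
proof -
  let ?form = "\<lambda>A B k \<psi>. a ^ 2 / 25 * (L \<psi> * eval_fps A (z_tilde \<psi>) + eval_fps B (z_tilde \<psi>)) / \<psi> ^ Suc k"
  have step: "x2 L (Suc (Suc k)) \<psi> =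
      ?form (- 5 * theta A - of_nat (Suc k) * A) (- 5 * theta B - of_nat (Suc k) * B - 5 * A) (Suc k) \<psi>"
    if "\<And>\<psi>. \<psi> \<in> U \<Longrightarrow> x2 L (Suc k) \<psi> = ?form A B k \<psi>"
      "\<And>\<psi>. \<psi> \<in> U \<Longrightarrow> norm (z_tilde \<psi>) < fps_conv_radius A"
      "\<And>\<psi>. \<psi> \<in> U \<Longrightarrow> norm (z_tilde \<psi>) < fps_conv_radius B" "\<psi> \<in> U" for k A B \<psi>
    using deriv_period_form[OF U that(4) nz that(2,3) branch_deriv that(1)]
    by (simp add: x2_def)
  have 1: "x2 L (Suc 0) \<psi> = ?form per0 per1 0 \<psi>" if "\<psi> \<in> U" for \<psi>
    using conv1[OF that] by (simp add: x2_def period2_def h1_eq a_def power_divide)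
  have 2: "x2 L (Suc (Suc 0)) \<psi> = ?form psi1 log1 (Suc 0) \<psi>" if "\<psi> \<in> U" for \<psi>
    using step[OF 1 conv0 conv1 that] by (simp add: psi1_def log1_def)
  have "psi2 = - 5 * theta psi1 - of_nat (Suc (Suc 0)) * psi1"
    by (simp add: psi1_def psi2_def)
  moreover have "log2 = - 5 * theta log1 - of_nat (Suc (Suc 0)) * log1 - 5 * psi1"
    by (simp add: log2_def)
  ultimately have 3: "x2 L (Suc (Suc (Suc 0))) \<psi> = ?form psi2 log2 (Suc (Suc 0)) \<psi>" if "\<psi> \<in> U" for \<psi>
    using step[OF 2 conv_psi(1,4) that] by simp
  show "x2 L 1 \<psi> = a ^ 2 / 25 * (L \<psi> * eval_fps per0 (z_tilde \<psi>) + eval_fps per1 (z_tilde \<psi>)) / \<psi>"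
    "x2 L 2 \<psi> = a ^ 2 / 25 * (L \<psi> * eval_fps psi1 (z_tilde \<psi>) + eval_fps log1 (z_tilde \<psi>)) / \<psi> ^ 2"
    "x2 L 3 \<psi> = a ^ 2 / 25 * (L \<psi> * eval_fps psi2 (z_tilde \<psi>) + eval_fps log2 (z_tilde \<psi>)) / \<psi> ^ 3"
    using 1[OF assms] 2[OF assms] 3[OF assms] by (simp_all add: eval_nat_numeral)
qed

end


section \<open>Comparison with the claimed formulas\<close>

text \<open>\<open>psi1 * per1 - per0 * log1\<close> is \<open>5 * pairing\<close>, the Wronskian in
  terms of \<psi>-derivatives.\<close>

lemma zsol_5_eq: "zsol 5 = - (fps_const (1/5) ^ 6 * disc * per0 ^ 2 * (psi1 * per1 - per0 * log1))"
proof -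
  define u :: "complex fps" where "u = fps_const (1/5)"
  have u: "5 * u = 1" by (simp add: u_def numeral_fps_const)
  show ?thesis
    unfolding zsol_simps wron_def pairing_def psi1_def log1_def u_def[symmetric] using u by algebra
qed

text \<open>Applies \<theta> to \<open>zsol_5_eq\<close> and re-expresses each \<theta>-derivative
  through the series of the next \<psi>-derivative.\<close>

lemma zsol_6_eq:
  "zsol 6 = kfac * (fps_const (1/5) ^ 6 * (3125 * fps_X * per0 ^ 2 * (psi1 * per1 - per0 * log1)
    + fps_const (2/5) * disc * per0 * (psi1 + per0) * (psi1 * per1 - per0 * log1)
    + fps_const (1/5) * disc * per0 ^ 2 * (psi2 * per1 - per0 * log2 + 3 * (psi1 * per1 - per0 * log1))))"
proof -
  define u :: "complex fps" where "u = fps_const (1/5)"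
  have u: "5 * u = 1" "fps_const (2/5) = 2 * u" by (simp_all add: u_def numeral_fps_const)
  have td: "theta disc = - 3125 * fps_X" "theta u = 0" by (simp_all add: disc_def u_def)
  have tp: "theta per0 = - u * (psi1 + per0)" unfolding psi1_def using u by algebra
  have tpsi1: "theta psi1 = - u * (psi2 + 2 * psi1)"
    by (simp add: psi1_def psi2_def) (use u in algebra)
  have tg: "theta per1 = - u * (log1 + per1 + 5 * per0)" unfolding log1_def using u by algebra
  have tl: "theta log1 = - u * (log2 + 2 * log1 + 5 * psi1)" unfolding log2_def using u by algebra
  have "theta (zsol 5) = - (u ^ 6 * ((theta disc * per0 ^ 2 + disc * 2 * per0 * theta per0) * (psi1 * per1 - per0 * log1)
    + disc * per0 ^ 2 * (theta psi1 * per1 + psi1 * theta per1 - theta per0 * log1 - per0 * theta log1)))"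
    unfolding zsol_5_eq u_def[symmetric] by (simp add: td algebra_simps)
  also have "\<dots> = u ^ 6 * (3125 * fps_X * per0 ^ 2 * (psi1 * per1 - per0 * log1)
    + 2 * u * disc * per0 * (psi1 + per0) * (psi1 * per1 - per0 * log1)
    + u * disc * per0 ^ 2 * (psi2 * per1 - per0 * log2 + 3 * (psi1 * per1 - per0 * log1)))"
    unfolding td tp tpsi1 tg tl by algebra
  finally show ?thesis
    using zsol_simps(6,7) unfolding u(2) u_def by simp
qed


text \<open>\<open>l\<close> stands for an arbitrary value of the logarithm. It cancels, since the
  second period enters \<open>t 5\<close> and \<open>t 6\<close> only through minors such as
  \<open>x12 * x21 - x11 * x22\<close>.\<close>

lemma evaluation:
  fixes \<psi> a l :: complex
  defines "z \<equiv> z_tilde \<psi>"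
  defines "p \<equiv> eval_fps per0 z" and "p1 \<equiv> eval_fps psi1 z" and "p2 \<equiv> eval_fps psi2 z"
    and "p3 \<equiv> eval_fps psi3 z" and "g \<equiv> eval_fps per1 z" and "g1 \<equiv> eval_fps log1 z"
    and "g2 \<equiv> eval_fps log2 z"
  defines "x11 \<equiv> a ^ 3 / 5 * p / \<psi>" and "x12 \<equiv> a ^ 3 / 5 * p1 / \<psi> ^ 2"
    and "x13 \<equiv> a ^ 3 / 5 * p2 / \<psi> ^ 3" and "x14 \<equiv> a ^ 3 / 5 * p3 / \<psi> ^ 4"
    and "x21 \<equiv> a ^ 2 / 25 * (l * p + g) / \<psi>" and "x22 \<equiv> a ^ 2 / 25 * (l * p1 + g1) / \<psi> ^ 2"
    and "x23 \<equiv> a ^ 2 / 25 * (l * p2 + g2) / \<psi> ^ 3"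
  assumes a: "a \<noteq> 0" and psi: "\<psi> \<noteq> 0"
    and conv: "norm z < fps_conv_radius per0" "norm z < fps_conv_radius per1"
  shows "eval_fps (zsol 0) z = a powi (-3) * \<psi> * x11"
    and "eval_fps (zsol 1) z = a powi (-6) * 625 * x11 *
             (5 * \<psi> ^ 3 * x12 + 5 * \<psi> ^ 4 * x13 + (\<psi> ^ 5 - 1) * x14)"
    and "eval_fps (zsol 2) z = a powi (-9) * (-625) * x11 ^ 2 *
             (5 * \<psi> ^ 3 * x11 + (\<psi> ^ 5 - 1) * x13)"
    and "eval_fps (zsol 3) z = a powi (-12) * 625 * x11 ^ 3 *
             (- 5 * \<psi> ^ 4 * x11 + (\<psi> ^ 5 - 1) * x12)"
    and "eval_fps (zsol 4) z = a powi (-15) * x11 ^ 5"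
    and "eval_fps (zsol 5) z = a powi (-11) * (-1 / 5) * (\<psi> ^ 5 - 1) * x11 ^ 2 *
             (x12 * x21 - x11 * x22)"
    and "eval_fps (zsol 6) z = a powi (-23) * (1 / 25) * (\<psi> ^ 5 - 1) * x11 ^ 5 *
             (- 5 * \<psi> ^ 4 * x11 * x12 * x21 - 2 * (\<psi> ^ 5 - 1) * x12 ^ 2 * x21
              - (\<psi> ^ 5 - 1) * x11 * x13 * x21 + 5 * \<psi> ^ 4 * x11 ^ 2 * x22
              + 2 * (\<psi> ^ 5 - 1) * x11 * x12 * x22 + (\<psi> ^ 5 - 1) * x11 ^ 2 * x23)"
proof -
  define s where "s = \<psi> ^ 5"
  have s: "s \<noteq> 0" using psi by (simp add: s_def)
  have z: "z = 1 / (3125 * s)" by (simp add: z_def z_tilde_def s_def)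
  have cp: "norm z < fps_conv_radius psi1" "norm z < fps_conv_radius psi2"
    "norm z < fps_conv_radius psi3" "norm z < fps_conv_radius log1" "norm z < fps_conv_radius log2"
    using conv by (simp_all add: psi1_def psi2_def psi3_def log1_def log2_def conv_radius_less_intros)
  note ev = eval_fps_add eval_fps_diff eval_fps_minus eval_fps_mult eval_fps_power conv_radius_less_intros
  have "eval_fps disc z = 1 - 1 / s"
    unfolding disc_def by (simp add: ev z)
  hence d: "eval_fps disc z = (s - 1) / s" "norm z < fps_conv_radius disc"
    using s by (simp_all add: disc_def conv_radius_less_intros divide_simps)
  have k: "eval_fps kfac z = - ((1/5) ^ 4 * ((s - 1) / s) * p ^ 4)" "norm z < fps_conv_radius kfac"
    unfolding kfac_def using d conv by (simp_all add: ev p_def)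
  note c = conv cp d k
  have e0: "eval_fps (zsol 0) z = p / 5"
    unfolding zsol_simps using c by (simp add: ev p_def)
  have e1: "eval_fps (zsol 1) z = 25 * p * (5 * p1 + 5 * p2 + (s - 1) / s * p3)"
    unfolding zsol_simps using c by (simp add: ev p_def p1_def p2_def p3_def)
  have e2: "eval_fps (zsol 2) z = - 5 * p ^ 2 * (5 * p + (s - 1) / s * p2)"
    unfolding zsol_simps using c by (simp add: ev p_def p2_def)
  have e3: "eval_fps (zsol 3) z = p ^ 3 * (- 5 * p + (s - 1) / s * p1)"
    unfolding zsol_simps using c by (simp add: ev p_def p1_def)
  have e4: "eval_fps (zsol 4) z = 1 / (3125 * s) * p ^ 5"
    unfolding zsol_simps using c by (simp add: ev p_def z)
  have e5: "eval_fps (zsol 5) z = - ((1/5) ^ 6 * ((s - 1) / s) * p ^ 2 * (p1 * g - p * g1))"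
    unfolding zsol_5_eq using c by (simp add: ev p_def p1_def g_def g1_def)
  have e6: "eval_fps (zsol 6) z = - ((1/5) ^ 4 * ((s - 1) / s) * p ^ 4) * ((1/5) ^ 6 * (1 / s * p ^ 2 * (p1 * g - p * g1)
    + 2/5 * ((s - 1) / s) * p * (p1 + p) * (p1 * g - p * g1)
    + 1/5 * ((s - 1) / s) * p ^ 2 * (p2 * g - p * g2 + 3 * (p1 * g - p * g1))))"
    unfolding zsol_6_eq using c by (simp add: ev p_def p1_def p2_def g_def g1_def g2_def) (simp add: z)
  note X = x11_def x12_def x13_def x14_def x21_def x22_def x23_def
  show "eval_fps (zsol 0) z = a powi (-3) * \<psi> * x11"
    unfolding e0 X using a psi by (simp add: power_int_minus divide_simps)
  show "eval_fps (zsol 1) z = a powi (-6) * 625 * x11 *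
             (5 * \<psi> ^ 3 * x12 + 5 * \<psi> ^ 4 * x13 + (\<psi> ^ 5 - 1) * x14)"
    unfolding e1 X s_def using a psi by (simp add: power_int_minus divide_simps) algebra
  show "eval_fps (zsol 2) z = a powi (-9) * (-625) * x11 ^ 2 *
             (5 * \<psi> ^ 3 * x11 + (\<psi> ^ 5 - 1) * x13)"
    unfolding e2 X s_def using a psi by (simp add: power_int_minus divide_simps) algebra
  show "eval_fps (zsol 3) z = a powi (-12) * 625 * x11 ^ 3 *
             (- 5 * \<psi> ^ 4 * x11 + (\<psi> ^ 5 - 1) * x12)"
    unfolding e3 X s_def using a psi by (simp add: power_int_minus divide_simps) algebra
  show "eval_fps (zsol 4) z = a powi (-15) * x11 ^ 5"
    unfolding e4 X s_def using a psi by (simp add: power_int_minus divide_simps)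
  show "eval_fps (zsol 5) z = a powi (-11) * (-1 / 5) * (\<psi> ^ 5 - 1) * x11 ^ 2 *
             (x12 * x21 - x11 * x22)"
    unfolding e5 X s_def using a psi by (simp add: power_int_minus divide_simps) algebra
  let ?B = "- 5 * \<psi> ^ 4 * x11 * x12 * x21 - 2 * (\<psi> ^ 5 - 1) * x12 ^ 2 * x21
              - (\<psi> ^ 5 - 1) * x11 * x13 * x21 + 5 * \<psi> ^ 4 * x11 ^ 2 * x22
              + 2 * (\<psi> ^ 5 - 1) * x11 * x12 * x22 + (\<psi> ^ 5 - 1) * x11 ^ 2 * x23"
  \<comment> \<open>\<open>V\<close> and \<open>V2\<close> are the two minors without
    \<open>l\<close>, and \<open>r\<close> is the value of \<open>disc\<close>. In these terms the
    formula for \<open>t 6\<close> factors and the final comparison stays small.\<close>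
  define V V2 r where "V = p1 * g - p * g1" and "V2 = p2 * g - p * g2" and "r = (s - 1) / s"
  have r: "1 / s = 1 - r" using s by (simp add: r_def divide_simps)
  have B: "?B = a ^ 8 / 625 * (- 5 * p * V - 2 * r * p1 * V - r * p * V2)"
    unfolding X V_def V2_def r_def s_def using psi by (simp add: divide_simps) algebra
  have x: "(\<psi> ^ 5 - 1) * x11 ^ 5 = a ^ 15 / 3125 * r * p ^ 5"
    unfolding r_def s_def x11_def using psi by (simp add: power_mult_distrib power_divide flip: power_mult)
  have one: "a powi (-23) * (a ^ 15 * a ^ 8) = 1"
    using a by (simp add: power_int_minus flip: power_add)
  have "a powi (-23) * (1 / 25) * (\<psi> ^ 5 - 1) * x11 ^ 5 * ?B =
      a powi (-23) * (1 / 25) * ((\<psi> ^ 5 - 1) * x11 ^ 5) * ?B" by (simp only: mult.assoc)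
  also have "\<dots> = (a powi (-23) * (a ^ 15 * a ^ 8)) *
      (r * p ^ 5 / 5 ^ 11 * (- 5 * p * V - 2 * r * p1 * V - r * p * V2))"
    unfolding x B by simp
  also have "\<dots> = eval_fps (zsol 6) z"
    unfolding one e6 V_def[symmetric] V2_def[symmetric] r_def[symmetric] r by (simp add: power_numeral_reduce) algebra
  finally show "eval_fps (zsol 6) z = a powi (-23) * (1 / 25) * (\<psi> ^ 5 - 1) * x11 ^ 5 *
             (- 5 * \<psi> ^ 4 * x11 * x12 * x21 - 2 * (\<psi> ^ 5 - 1) * x12 ^ 2 * x21
              - (\<psi> ^ 5 - 1) * x11 * x13 * x21 + 5 * \<psi> ^ 4 * x11 ^ 2 * x22
              + 2 * (\<psi> ^ 5 - 1) * x11 * x12 * x22 + (\<psi> ^ 5 - 1) * x11 ^ 2 * x23)"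
    by (rule sym)
qed

section \<open>Passage to neighbourhoods of infinity\<close>

lemma eventually_mirror_map:
  "eventually (\<lambda>z. norm z < fps_conv_radius per0 \<and> norm z < fps_conv_radius per1 \<and>
     eval_fps per0 z \<noteq> 0 \<and> eval_fps nome z = z * exp (eval_fps per1 z / eval_fps per0 z) \<and>
     (\<forall>i\<in>{..6}. eval_fps (qsol i) (eval_fps nome z) = eval_fps (zsol i) z) \<and>
     (\<forall>i\<in>{..6}. ereal (norm (eval_fps nome z)) < fps_conv_radius (qsol i))) (nhds 0)"
proof (intro eventually_conj eventually_ball_finite finite_atMost ballI qsol_expansion; (elim atMost_iff[THEN iffD1])?)
  have "\<forall>\<^sub>F z in nhds (0::complex). norm z < r" if "r > 0" for r :: ereal
    using eventually_nhds_in_open[of "eball (0::complex) r" 0] that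
    by (simp add: zero_ereal_def)
  thus "\<forall>\<^sub>F z in nhds (0::complex). norm z < fps_conv_radius per0"
    "\<forall>\<^sub>F z in nhds (0::complex). norm z < fps_conv_radius per1"
    using conv_radius_per0 conv_radius_per1 by blast+
  have "isCont (eval_fps per0) 0"
    using has_fps_expansion_imp_continuous[OF eval_fps_has_fps_expansion[OF conv_radius_per0], of UNIV] by simp
  hence "(eval_fps per0 \<longlongrightarrow> eval_fps per0 0) (nhds 0)"
    by (simp add: isCont_def tendsto_at_iff_tendsto_nhds)
  thus "\<forall>\<^sub>F z in nhds 0. eval_fps per0 z \<noteq> 0"
    by (rule tendsto_imp_eventually_ne) (simp add: eval_fps_at_0 per0_nth_0)
  show "\<forall>\<^sub>F z in nhds 0. eval_fps nome z = z * exp (eval_fps per1 z / eval_fps per0 z)"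
    using nome_expansion by (simp add: has_fps_expansion_def)
qed

lemma z_tilde_tendsto_0: "(z_tilde \<longlongrightarrow> 0) at_infinity"
  unfolding z_tilde_def[abs_def]
  by (intro tendsto_divide_0[OF tendsto_const] tendsto_mult_filterlim_at_infinity[OF tendsto_const]
      filterlim_power_at_infinity filterlim_ident) auto

theorem theorem3:
  fixes t :: "nat \<Rightarrow> complex fps"
  assumes "differential_system t"
    and "fps_nth (t 0) 0 = 1 / 5"
    and "fps_nth (t 0) 1 = 24"
    and "fps_nth (t 4) 0 = 0"
    and "fps_nth (t 5) 0 \<noteq> 0"
  shows "(\<forall>i\<le>6. fps_conv_radius (t i) > 0) \<and>
    (\<exists>R>0. \<forall>U L. open U \<and> U \<subseteq> {\<psi>. norm \<psi> > R} \<and> log_branch U L \<longrightarrow>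
      (\<forall>\<psi>\<in>U.
        let a = 2 * of_real pi * \<i> / 5;
            x11 = x1 1 \<psi>; x12 = x1 2 \<psi>; x13 = x1 3 \<psi>; x14 = x1 4 \<psi>;
            x21 = x2 L 1 \<psi>; x22 = x2 L 2 \<psi>; x23 = x2 L 3 \<psi>;
            q = exp (2 * of_real pi * \<i> * (x21 / x11))
        in (\<forall>i\<le>6. ereal (norm q) < fps_conv_radius (t i)) \<and>
           eval_fps (t 0) q = a powi (-3) * \<psi> * x11 \<and>
           eval_fps (t 1) q = a powi (-6) * 625 * x11 *
             (5 * \<psi> ^ 3 * x12 + 5 * \<psi> ^ 4 * x13 + (\<psi> ^ 5 - 1) * x14) \<and>
           eval_fps (t 2) q = a powi (-9) * (-625) * x11 ^ 2 *
             (5 * \<psi> ^ 3 * x11 + (\<psi> ^ 5 - 1) * x13) \<and>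
           eval_fps (t 3) q = a powi (-12) * 625 * x11 ^ 3 *
             (- 5 * \<psi> ^ 4 * x11 + (\<psi> ^ 5 - 1) * x12) \<and>
           eval_fps (t 4) q = a powi (-15) * x11 ^ 5 \<and>
           eval_fps (t 5) q = a powi (-11) * (-1 / 5) * (\<psi> ^ 5 - 1) * x11 ^ 2 *
             (x12 * x21 - x11 * x22) \<and>
           eval_fps (t 6) q = a powi (-23) * (1 / 25) * (\<psi> ^ 5 - 1) * x11 ^ 5 *
             (- 5 * \<psi> ^ 4 * x11 * x12 * x21 - 2 * (\<psi> ^ 5 - 1) * x12 ^ 2 * x21
              - (\<psi> ^ 5 - 1) * x11 * x13 * x21 + 5 * \<psi> ^ 4 * x11 ^ 2 * x22
              + 2 * (\<psi> ^ 5 - 1) * x11 * x12 * x22 + (\<psi> ^ 5 - 1) * x11 ^ 2 * x23)))"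
proof -
  have t: "t i = qsol i" if "i \<le> 6" for i
    using assms differential_system_iff_cleared[of t, OF assms(5)] qsol_system qsol_initial that
    by (intro system_unique) auto
  obtain b where b: "\<And>\<psi>. norm \<psi> \<ge> b \<Longrightarrow> norm (z_tilde \<psi>) < fps_conv_radius per0 \<and>
     norm (z_tilde \<psi>) < fps_conv_radius per1 \<and> eval_fps per0 (z_tilde \<psi>) \<noteq> 0 \<and>
     eval_fps nome (z_tilde \<psi>) = z_tilde \<psi> * exp (eval_fps per1 (z_tilde \<psi>) / eval_fps per0 (z_tilde \<psi>)) \<and>
     (\<forall>i\<in>{..6}. eval_fps (qsol i) (eval_fps nome (z_tilde \<psi>)) = eval_fps (zsol i) (z_tilde \<psi>)) \<and>
     (\<forall>i\<in>{..6}. ereal (norm (eval_fps nome (z_tilde \<psi>))) < fps_conv_radius (qsol i))"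
    using eventually_compose_filterlim[OF eventually_mirror_map z_tilde_tendsto_0]
    unfolding eventually_at_infinity by blast
  \<comment> \<open>The bound 1 makes \<open>R\<close> positive and excludes
    \<open>\<psi> = 0\<close> from \<open>U\<close>.\<close>
  define R where "R = max 1 b"
  have "R > 0" by (simp add: R_def)
  show ?thesis
  proof (intro conjI allI impI exI[of _ R] ballI)
    show "fps_conv_radius (t i) > 0" if "i \<le> 6" for i
      using qsol_expansion(1)[OF that] t[OF that] by simp
    show "R > 0" by fact
  next
    fix U L \<psi>
    assume *: "open U \<and> U \<subseteq> {\<psi>. norm \<psi> > R} \<and> log_branch U L" and psi: "\<psi> \<in> U"
    define a :: complex where "a = 2 * of_real pi * \<i> / 5"
    define z where "z = z_tilde \<psi>"
    have a: "a \<noteq> 0" by (simp add: a_def)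
    have large: "norm \<phi> \<ge> b" "\<phi> \<noteq> 0" if "\<phi> \<in> U" for \<phi>
      using * that by (auto simp: R_def)
    note U = conjunct1[OF *] conjunct2[OF conjunct2[OF *]]
    note X1 = x1_values[OF U large(2) _ _ psi, folded a_def z_def]
    note X2 = x2_values[OF U large(2) _ _ psi, folded a_def z_def]
    have conv: "norm z < fps_conv_radius per0" "norm z < fps_conv_radius per1"
      using b large(1)[OF psi] by (auto simp: z_def)
    have X: "x1 1 \<psi> = a ^ 3 / 5 * eval_fps per0 z / \<psi>" "x1 2 \<psi> = a ^ 3 / 5 * eval_fps psi1 z / \<psi> ^ 2"
      "x1 3 \<psi> = a ^ 3 / 5 * eval_fps psi2 z / \<psi> ^ 3" "x1 4 \<psi> = a ^ 3 / 5 * eval_fps psi3 z / \<psi> ^ 4"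
      "x2 L 1 \<psi> = a ^ 2 / 25 * (L \<psi> * eval_fps per0 z + eval_fps per1 z) / \<psi>"
      "x2 L 2 \<psi> = a ^ 2 / 25 * (L \<psi> * eval_fps psi1 z + eval_fps log1 z) / \<psi> ^ 2"
      "x2 L 3 \<psi> = a ^ 2 / 25 * (L \<psi> * eval_fps psi2 z + eval_fps log2 z) / \<psi> ^ 3"
      using b large(1) by (intro X1 X2; blast)+
    have p: "eval_fps per0 z \<noteq> 0" using b large(1)[OF psi] by (simp add: z_def)
    \<comment> \<open>The constants \<open>a ^ 2 / 25\<close> and \<open>a ^ 3 / 5\<close> of the
      two periods combine with \<open>5 * a\<close> to 1, so the exponent is exactly
      \<open>L \<psi>\<close> plus the quotient of the two series.\<close>
    have "2 * of_real pi * \<i> = 5 * a" by (simp add: a_def)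
    hence "2 * of_real pi * \<i> * (x2 L 1 \<psi> / x1 1 \<psi>) = L \<psi> + eval_fps per1 z / eval_fps per0 z"
      unfolding X using a p large(2)[OF psi] by (simp add: divide_simps power_numeral_reduce)
    moreover have "exp (L \<psi>) = z" using U(2) psi by (simp add: log_branch_def z_def)
    ultimately have q: "exp (2 * of_real pi * \<i> * (x2 L 1 \<psi> / x1 1 \<psi>)) = eval_fps nome z"
      using b large(1)[OF psi] by (simp add: exp_add z_def)
    have T: "eval_fps (t i) (eval_fps nome z) = eval_fps (zsol i) z"
      "ereal (norm (eval_fps nome z)) < fps_conv_radius (t i)" if "i \<le> 6" for i
      using b[OF large(1)[OF psi]] that t[OF that] by (auto simp: z_def)
    note E = evaluation[OF a large(2)[OF psi] conv[unfolded z_def], folded z_def]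
    show "let a = 2 * of_real pi * \<i> / 5;
            x11 = x1 1 \<psi>; x12 = x1 2 \<psi>; x13 = x1 3 \<psi>; x14 = x1 4 \<psi>;
            x21 = x2 L 1 \<psi>; x22 = x2 L 2 \<psi>; x23 = x2 L 3 \<psi>;
            q = exp (2 * of_real pi * \<i> * (x21 / x11))
        in (\<forall>i\<le>6. ereal (norm q) < fps_conv_radius (t i)) \<and>
           eval_fps (t 0) q = a powi (-3) * \<psi> * x11 \<and>
           eval_fps (t 1) q = a powi (-6) * 625 * x11 *
             (5 * \<psi> ^ 3 * x12 + 5 * \<psi> ^ 4 * x13 + (\<psi> ^ 5 - 1) * x14) \<and>
           eval_fps (t 2) q = a powi (-9) * (-625) * x11 ^ 2 *
             (5 * \<psi> ^ 3 * x11 + (\<psi> ^ 5 - 1) * x13) \<and>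
           eval_fps (t 3) q = a powi (-12) * 625 * x11 ^ 3 *
             (- 5 * \<psi> ^ 4 * x11 + (\<psi> ^ 5 - 1) * x12) \<and>
           eval_fps (t 4) q = a powi (-15) * x11 ^ 5 \<and>
           eval_fps (t 5) q = a powi (-11) * (-1 / 5) * (\<psi> ^ 5 - 1) * x11 ^ 2 *
             (x12 * x21 - x11 * x22) \<and>
           eval_fps (t 6) q = a powi (-23) * (1 / 25) * (\<psi> ^ 5 - 1) * x11 ^ 5 *
             (- 5 * \<psi> ^ 4 * x11 * x12 * x21 - 2 * (\<psi> ^ 5 - 1) * x12 ^ 2 * x21
              - (\<psi> ^ 5 - 1) * x11 * x13 * x21 + 5 * \<psi> ^ 4 * x11 ^ 2 * x22
              + 2 * (\<psi> ^ 5 - 1) * x11 * x12 * x22 + (\<psi> ^ 5 - 1) * x11 ^ 2 * x23)"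
      unfolding Let_def q a_def[symmetric] unfolding X
      by (intro conjI allI impI T(2); (assumption | subst T(1)); (rule E | simp))
  qed
qed

end
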